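(* Let $\Omega\subset\mathbb{C}^n$ be a bounded convex domain with $\mathcal{C}^1$-smooth boundary that is $\mathbb{C}$-strictly convex. Suppose that there exist a constant $r>0$, a function $\omega:[0,2r)\to[0,\infty)$ satisfying a Dini condition, and a defining function $\rho$ for $\Omega$ such that for each $\xi\in\partial\Omega$ the directional derivative $D_{i\eta^{\xi}}\rho$ has modulus of continuity $\omega$ on the ball $B^{(n)}(\xi,r)$. Then every complex geodesic $F:\mathbb{D}\to\Omega$ of $\Omega$ extends continuously to $\overline{\mathbb{D}}$.
   Context: Notation: $\mathbb{D}$ is the open unit disk in $\mathbb{C}$; $\mathbb{C}^n$ is identified with $\mathbb{R}^{2n}$ in the usual way; $B^{(n)}(a,r)$ is the open Euclidean ball in $\mathbb{C}^n$ with centre $a$ and radius $r$. A complex geodesic of $\Omega$ is a holomorphic map $F:\mathbb{D}\to\Omega$ that is an isometry with respect to the Kobayashi distances on $\mathbb{D}$ and $\Omega$, i.e. $\mathsf{k}_\Omega(F(z),F(w))=\mathsf{k}_{\mathbb{D}}(z,w)$ for all $z,w\in\mathbb{D}$. Boundary data: a defining function for a bounded domain $\Omega$ with $\mathcal{C}^1$ boundary is a real-valued $\mathcal{C}^1$ function $\rho$ on a neighbourhood $U$ of $\partial\Omega$ with $\Omega\cap U=\{\rho<0\}$, $\partial\Omega=\{\rho=0\}$, and $D\rho\neq 0$ on $\partial\Omega$; $U$ is understood to contain the balls $B^{(n)}(\xi,r)$, $\xi\in\partial\Omega$, occurring in the statement. For $\xi\in\partial\Omega$, $\eta^\xi$ is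 the unit inward-pointing normal to $\partial\Omega$ at $\xi$, regarded as a vector in $\mathbb{C}^n$, and $i\eta^\xi$ is its product with $i$. For a unit vector $v$, $D_v\rho$ is the real directional derivative of $\rho$ in the direction $v$. Modulus of continuity: a function $f$ on a ball $B^{(n)}(\xi,r)$ has modulus of continuity $\omega:[0,2r)\to[0,\infty)$ if $\omega$ is non-decreasing, $\omega(0)=0$, $\omega$ is continuous at $0$, and $|f(x)-f(y)|\le\omega(\|x-y\|)$ for all $x,y$ in the ball. Dini condition: a Lebesgue-measurable $g:[0,\epsilon_0)\to[0,\infty)$, $\epsilon_0>0$, satisfies a Dini condition if $\int_0^{\epsilon_0}\frac{g(t)}{t}\,dt<\infty$. $\mathbb{C}$-strict convexity: a convex domain $\Omega\subset\mathbb{C}^n$ with $\mathcal{C}^1$ boundary is $\mathbb{C}$-strictly convex if $(\xi+T^{\mathbb{C}}_\xi(\partial\Omega))\cap\overline\Omega=\{\xi\}$ for every $\xi\in\partial\Omega$, where $T_\xi(\partial\Omega)$ is the real tangent space viewed as a real hyperplane (linear subspace) of $\mathbb{R}^{2n}\equiv\mathbb{C}^n$ and $T^{\mathbb{C}}_\xi(\partial\Omega)=T_\xi(\partial\Omega)\cap iT_\xi(\partial\Omega)$. *)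

theory Defs
  imports "HOL-Complex_Analysis.Complex_Analysis"
begin

text \<open>
  The space of \<open>n\<close> complex variables is \<^typ>\<open>complex ^ 'n\<close>. Its library norm and (real) inner product
  are the Euclidean ones of the underlying real space of dimension \<open>2n\<close>. Multiplication by the
  imaginary unit is \<^term>\<open>(*s) \<i>\<close>.
\<close>

definition poincare_dist :: "complex \<Rightarrow> complex \<Rightarrow> real" where
  "poincare_dist z w = artanh (cmod ((z - w) / (1 - cnj w * z)))"

text \<open>
  The chain construction of the Kobayashi (pseudo)distance of a complex manifold: \<open>H\<close> is the set of
  holomorphic discs in it, and the infimum is taken over all finite chains of discs joining
  \<open>x = p 0\<close> to \<open>y = p m\<close>. On a connected manifold such chains exist.
\<close>

definition kobayashi_from_discs :: "(complex \<Rightarrow> 'a) set \<Rightarrow> 'a \<Rightarrow> 'a \<Rightarrow> real" where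
  "kobayashi_from_discs H x y =
     Inf {L. \<exists>m p f a b.
            p 0 = x \<and> p m = y \<and>
            (\<forall>j<m. f j \<in> H \<and> a j \<in> ball 0 1 \<and> b j \<in> ball 0 1 \<and>
                   f j (a j) = p j \<and> f j (b j) = p (Suc j)) \<and>
            L = (\<Sum>j<(m::nat). poincare_dist (a j) (b j))}"

definition holomorphic_discs :: "(complex ^ 'n) set \<Rightarrow> (complex \<Rightarrow> complex ^ 'n) set" where
  "holomorphic_discs \<Omega> =
     {f. (\<forall>k. (\<lambda>z. f z $ k) holomorphic_on ball 0 1) \<and> f ` ball 0 1 \<subseteq> \<Omega>}"

definition kobayashi_dist :: "(complex ^ 'n) set \<Rightarrow> complex ^ 'n \<Rightarrow> complex ^ 'n \<Rightarrow> real" where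
  "kobayashi_dist \<Omega> = kobayashi_from_discs (holomorphic_discs \<Omega>)"

definition kobayashi_dist_disc :: "complex \<Rightarrow> complex \<Rightarrow> real" where
  "kobayashi_dist_disc =
     kobayashi_from_discs {f. f holomorphic_on ball 0 1 \<and> f ` ball 0 1 \<subseteq> ball 0 1}"

definition complex_geodesic :: "(complex ^ 'n) set \<Rightarrow> (complex \<Rightarrow> complex ^ 'n) \<Rightarrow> bool" where
  "complex_geodesic \<Omega> F \<longleftrightarrow>
     F \<in> holomorphic_discs \<Omega> \<and>
     (\<forall>z\<in>ball 0 1. \<forall>w\<in>ball 0 1. kobayashi_dist \<Omega> (F z) (F w) = kobayashi_dist_disc z w)"

definition C1_on :: "('a::real_normed_vector \<Rightarrow> real) \<Rightarrow> 'a set \<Rightarrow> bool" where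
  "C1_on f U \<longleftrightarrow>
     (\<exists>f'. (\<forall>x\<in>U. (f has_derivative blinfun_apply (f' x)) (at x)) \<and> continuous_on U f')"

text \<open>
  \<open>\<rho>\<close> is a defining function of the part of the boundary of \<open>\<Omega>\<close> lying in the open set \<open>U\<close>. If
  \<open>frontier \<Omega> \<subseteq> U\<close>, it is a (global) defining function for \<open>\<Omega>\<close>.
\<close>

definition defining_function_on ::
    "('a::real_normed_vector) set \<Rightarrow> 'a set \<Rightarrow> ('a \<Rightarrow> real) \<Rightarrow> bool" where
  "defining_function_on \<Omega> U \<rho> \<longleftrightarrow>
     open U \<and> C1_on \<rho> U \<and>
     \<Omega> \<inter> U = {x\<in>U. \<rho> x < 0} \<and>
     frontier \<Omega> \<inter> U = {x\<in>U. \<rho> x = 0} \<and>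
     (\<forall>x\<in>frontier \<Omega> \<inter> U. frechet_derivative \<rho> (at x) \<noteq> (\<lambda>_. 0))"

definition defining_function ::
    "('a::real_normed_vector) set \<Rightarrow> 'a set \<Rightarrow> ('a \<Rightarrow> real) \<Rightarrow> bool" where
  "defining_function \<Omega> U \<rho> \<longleftrightarrow> frontier \<Omega> \<subseteq> U \<and> defining_function_on \<Omega> U \<rho>"

definition C1_boundary :: "('a::real_normed_vector) set \<Rightarrow> bool" where
  "C1_boundary \<Omega> \<longleftrightarrow> (\<forall>\<xi>\<in>frontier \<Omega>. \<exists>U \<rho>. \<xi> \<in> U \<and> defining_function_on \<Omega> U \<rho>)"

text \<open>
  The kernel of the derivative at \<open>\<xi>\<close> is the same for all local defining functions around \<open>\<xi>\<close>, so
  that the existential quantifier only serves to pick one of them.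
\<close>

definition tangent_space :: "('a::real_normed_vector) set \<Rightarrow> 'a \<Rightarrow> 'a set" where
  "tangent_space \<Omega> \<xi> =
     {v. \<exists>U \<rho>. \<xi> \<in> U \<and> defining_function_on \<Omega> U \<rho> \<and> frechet_derivative \<rho> (at \<xi>) v = 0}"

definition complex_tangent_space :: "(complex ^ 'n) set \<Rightarrow> complex ^ 'n \<Rightarrow> (complex ^ 'n) set" where
  "complex_tangent_space \<Omega> \<xi> = tangent_space \<Omega> \<xi> \<inter> (\<lambda>v. \<i> *s v) ` tangent_space \<Omega> \<xi>"

definition C_strictly_convex :: "(complex ^ 'n) set \<Rightarrow> bool" where
  "C_strictly_convex \<Omega> \<longleftrightarrow>
     convex \<Omega> \<and> C1_boundary \<Omega> \<and>
     (\<forall>\<xi>\<in>frontier \<Omega>. (\<lambda>v. \<xi> + v) ` complex_tangent_space \<Omega> \<xi> \<inter> closure \<Omega> = {\<xi>})"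

definition inward_unit_normal :: "('a::real_inner) set \<Rightarrow> 'a \<Rightarrow> 'a" where
  "inward_unit_normal \<Omega> \<xi> =
     (THE \<eta>. norm \<eta> = 1 \<and> (\<forall>v\<in>tangent_space \<Omega> \<xi>. \<eta> \<bullet> v = 0) \<and>
             (\<exists>\<epsilon>>0. \<forall>t. 0 < t \<and> t < \<epsilon> \<longrightarrow> \<xi> + t *\<^sub>R \<eta> \<in> \<Omega>))"

definition dir_deriv :: "'a::real_vector \<Rightarrow> ('a \<Rightarrow> real) \<Rightarrow> 'a \<Rightarrow> real" where
  "dir_deriv v f x = deriv (\<lambda>t::real. f (x + t *\<^sub>R v)) 0"

definition has_modulus_of_continuity ::
    "('a::real_normed_vector \<Rightarrow> real) \<Rightarrow> 'a \<Rightarrow> real \<Rightarrow> (real \<Rightarrow> real) \<Rightarrow> bool" where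
  "has_modulus_of_continuity f \<xi> r \<omega> \<longleftrightarrow>
     \<omega> ` {0..<2 * r} \<subseteq> {0..} \<and> mono_on {0..<2 * r} \<omega> \<and> \<omega> 0 = 0 \<and>
     continuous (at 0 within {0..<2 * r}) \<omega> \<and>
     (\<forall>x\<in>ball \<xi> r. \<forall>y\<in>ball \<xi> r. \<bar>f x - f y\<bar> \<le> \<omega> (norm (x - y)))"

definition dini_condition :: "real \<Rightarrow> (real \<Rightarrow> real) \<Rightarrow> bool" where
  "dini_condition \<epsilon> g \<longleftrightarrow>
     \<epsilon> > 0 \<and> g ` {0..<\<epsilon>} \<subseteq> {0..} \<and> g \<in> borel_measurable (lebesgue_on {0..<\<epsilon>}) \<and>
     (\<integral>\<^sup>+ t\<in>{0<..<\<epsilon>}. ennreal (g t / t) \<partial>lebesgue) < \<infinity>"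

end

theory Submission
  imports Defs
begin

text \<open>
  Write \<open>\<delta>\<close> for the distance to the boundary. The Dini condition makes \<open>\<Omega>\<close> contain, in the complex
  normal line at each boundary point \<open>\<xi>\<close>, the region \<open>\<bar>b\<bar> * \<omega> \<bar>b\<bar> < c * a\<close>, where \<open>\<xi> + a \<eta> + i b \<eta>\<close> is the
  point with coordinates \<open>(a, b)\<close>. A chain of discs of radii \<open>R / 2 ^ j\<close> inside it gives
  \<open>k(F 0, x) \<le> C - ln (\<delta> x) / 2\<close>. Conversely, \<open>\<complex>\<close>-strict convexity yields
  \<open>k(x, y) \<ge> - ln (\<delta> x) / 2 - C'\<close> whenever \<open>y\<close> stays away from the boundary point nearest to \<open>x\<close>.
  Apply this to \<open>x = F z\<close> and \<open>y = F (t z)\<close> with \<open>0 \<le> t \<le> 1\<close>: in the disc,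
  \<open>k(z, t z) = k(0, z) - k(0, t z)\<close>, so if \<open>F z\<close> and \<open>F (t z)\<close> are far apart, then \<open>k(0, t z)\<close> is
  bounded. Hence \<open>F\<close> oscillates little on the radial segments near the circle, uniformly in the
  direction. It is therefore uniformly continuous.
\<close>

subsection \<open>The Poincare distance and chains of discs\<close>

lemma artanh_real_eq:
  fixes x :: real
  assumes "\<bar>x\<bar> < 1"
  shows "artanh x = (ln (1 + x) - ln (1 - x)) / 2"
  using assms by (simp add: artanh_def ln_div abs_less_iff)

lemma artanh_real_mono:
  fixes x y :: real
  assumes "-1 < x" "x \<le> y" "y < 1"
  shows "artanh x \<le> artanh y"
proof -
  have "ln (1 + x) \<le> ln (1 + y)" "ln (1 - y) \<le> ln (1 - x)"
    using assms by simp_all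
  then show ?thesis
    using assms by (simp add: artanh_real_eq divide_right_mono diff_mono)
qed

lemma artanh_real_nonneg:
  fixes x :: real
  assumes "0 \<le> x" "x < 1"
  shows "0 \<le> artanh x"
  using artanh_real_mono[of 0 x] assms by simp

text \<open>Both \<open>1 + q\<close> and \<open>1 - q\<close> factor for this quotient
  \<open>q\<close>, so the logarithms separate. This is additivity of hyperbolic distance along a
  radius of the disc.\<close>

lemma artanh_diff_real:
  fixes x y :: real
  assumes "0 \<le> x" "x \<le> y" "y < 1"
  shows "artanh ((y - x) / (1 - x * y)) = artanh y - artanh x"
proof -
  have "x * y < 1"
    using assms mult_mono[of x 1 y y] by linarith
  then have pos: "1 - x * y > 0" by simp
  have eq1: "1 + (y - x) / (1 - x * y) = (1 + y) * (1 - x) / (1 - x * y)"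
    using pos by (simp add: field_simps)
  have eq2: "1 - (y - x) / (1 - x * y) = (1 - y) * (1 + x) / (1 - x * y)"
    using pos by (simp add: field_simps)
  have q: "\<bar>(y - x) / (1 - x * y)\<bar> < 1"
  proof -
    have "(1 - y) * (1 + x) / (1 - x * y) > 0"
      using assms pos by simp
    then have "(y - x) / (1 - x * y) < 1"
      using eq2 by linarith
    moreover have "(y - x) / (1 - x * y) \<ge> 0"
      using assms pos by simp
    ultimately show ?thesis by linarith
  qed
  show ?thesis
    using assms pos
    by (simp only: artanh_real_eq[OF q] eq1 eq2)
      (simp add: artanh_real_eq ln_mult ln_div diff_divide_distrib add_divide_distrib)
qed

text \<open>Because \<open>1 - q\<^sup>2 = (1 + q) * (1 - q)\<close>, \<open>artanh q\<close> equals
  \<open>ln (1 + q) - ln (1 - q\<^sup>2) / 2\<close>, whose first term is nonnegative.\<close>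

lemma half_neg_ln_le_artanh:
  fixes q :: real
  assumes "0 \<le> q" "q < 1" "0 < s" "1 - q\<^sup>2 \<le> s"
  shows "- ln s / 2 \<le> artanh q"
proof -
  have "q\<^sup>2 < 1"
    using assms by (simp add: abs_square_less_1)
  have "1 - q\<^sup>2 = (1 + q) * (1 - q)"
    by (simp add: power2_eq_square algebra_simps)
  then have "ln (1 + q) + ln (1 - q) \<le> ln s"
    using assms \<open>q\<^sup>2 < 1\<close> ln_mono[of "1 - q\<^sup>2" s] by (simp add: ln_mult)
  moreover have "0 \<le> ln (1 + q)"
    using assms by simp
  moreover have "artanh q = (ln (1 + q) - ln (1 - q)) / 2"
    using assms by (intro artanh_real_eq) auto
  ultimately show ?thesis
    by argo
qed

text \<open>For given moduli the pseudohyperbolic distance is least when both points lie on one ray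
  from \<open>0\<close>. By the identity \<open>pick\<close>, one minus its square has a fixed
  numerator over the square of \<open>cmod (1 - cnj w * z)\<close>, and the triangle inequality
  bounds that denominator from below.\<close>

lemma cmod_Moebius_function_lower:
  assumes "cmod z < 1" "cmod w < 1" "cmod z \<le> cmod w"
  shows "(cmod w - cmod z) / (1 - cmod z * cmod w) \<le> cmod (Moebius_function 0 w z)"
proof -
  have pos: "0 < 1 - cmod z * cmod w"
    using assms mult_mono[of "cmod z" 1 "cmod w" "cmod w"] by auto
  have le: "1 - cmod z * cmod w \<le> cmod (1 - cnj w * z)"
    using norm_triangle_ineq2[of 1 "cnj w * z"] by (simp add: norm_mult mult.commute)
  have ne: "1 - cnj w * z \<noteq> 0"
    using le pos by auto
  have pick: "(cmod (z - w))\<^sup>2 = (cmod (1 - cnj w * z))\<^sup>2 - (1 - (cmod w)\<^sup>2) * (1 - (cmod z)\<^sup>2)"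
    unfolding cmod_power2 by (simp add: algebra_simps power2_eq_square)
  have nn: "0 \<le> (1 - (cmod w)\<^sup>2) * (1 - (cmod z)\<^sup>2)"
    using assms by (intro mult_nonneg_nonneg) (simp_all add: abs_square_le_1)
  have sq: "(1 - cmod z * cmod w)\<^sup>2 \<le> (cmod (1 - cnj w * z))\<^sup>2"
    using le pos by (intro power_mono) auto
  have "((cmod w - cmod z) / (1 - cmod z * cmod w))\<^sup>2
      = 1 - (1 - (cmod w)\<^sup>2) * (1 - (cmod z)\<^sup>2) / (1 - cmod z * cmod w)\<^sup>2"
  proof -
    have "(1 - cmod z * cmod w)\<^sup>2 - (cmod w - cmod z)\<^sup>2 = (1 - (cmod w)\<^sup>2) * (1 - (cmod z)\<^sup>2)"
      by (simp add: power2_eq_square algebra_simps)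
    then show ?thesis
      using pos by (simp add: power_divide field_simps)
  qed
  also have "\<dots> \<le> 1 - (1 - (cmod w)\<^sup>2) * (1 - (cmod z)\<^sup>2) / (cmod (1 - cnj w * z))\<^sup>2"
    using nn sq pos ne by (simp add: divide_left_mono)
  also have "\<dots> = (cmod (Moebius_function 0 w z))\<^sup>2"
    using ne by (simp add: Moebius_function_simple norm_divide power_divide pick)
      (simp add: diff_divide_distrib)
  finally show ?thesis
    by (rule power2_le_imp_le) simp
qed

text \<open>Precomposing with the disc automorphism that takes \<open>0\<close> to \<open>b\<close>
  and postcomposing with the one that takes \<open>g b\<close> to \<open>0\<close> gives a self-map
  of the disc fixing \<open>0\<close>, to which the Schwarz lemma applies.\<close>

lemma Schwarz_Pick:
  assumes hol: "g holomorphic_on ball 0 1" and g: "g ` ball 0 1 \<subseteq> ball 0 1"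
    and a: "cmod a < 1" and b: "cmod b < 1"
  shows "cmod (Moebius_function 0 (g b) (g a)) \<le> cmod (Moebius_function 0 b a)"
proof -
  let ?k = "Moebius_function 0 (g b) \<circ> g \<circ> Moebius_function 0 (- b)"
  have gb: "cmod (g b) < 1"
    using g b by (auto simp: image_subset_iff)
  have M: "Moebius_function 0 (- b) ` ball 0 1 \<subseteq> ball 0 1"
    using b Moebius_function_norm_lt_1[of "- b" _ 0] by auto
  have k: "?k holomorphic_on ball 0 1"
    using b gb hol g M
    by (intro holomorphic_on_compose_gen[where t = "ball 0 1"] Moebius_function_holomorphic)
      (auto simp: image_comp)
  have k1: "cmod (?k z) < 1" if "cmod z < 1" for z
    using that M g gb by (auto simp: image_subset_iff intro!: Moebius_function_norm_lt_1)
  have "cmod (Moebius_function 0 b a) < 1"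
    using a b by (rule Moebius_function_norm_lt_1[rotated])
  moreover have "?k 0 = 0"
    by (simp add: Moebius_function_of_zero Moebius_function_eq_zero)
  ultimately have "cmod (?k (Moebius_function 0 b a)) \<le> cmod (Moebius_function 0 b a)"
    using Schwarz_Lemma(1)[OF k] k1 by blast
  then show ?thesis
    using Moebius_function_compose[of "- b" b a] a b by simp
qed

lemma poincare_dist_Moebius: "poincare_dist z w = artanh (cmod (Moebius_function 0 w z))"
  by (simp add: poincare_dist_def Moebius_function_simple)

lemma poincare_dist_nonneg:
  assumes "z \<in> ball 0 1" "w \<in> ball 0 1"
  shows "0 \<le> poincare_dist z w"
  using assms by (simp add: poincare_dist_Moebius artanh_real_nonneg Moebius_function_norm_lt_1)

text \<open>A triangle inequality with one vertex at \<open>0\<close>, combined with Schwarz-Pick.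
  It controls a single link of a chain after the link has been mapped into the disc.\<close>

lemma artanh_cmod_le_poincare_dist:
  assumes hol: "g holomorphic_on ball 0 1" and g: "g ` ball 0 1 \<subseteq> ball 0 1"
    and a: "a \<in> ball 0 1" and b: "b \<in> ball 0 1"
  shows "artanh (cmod (g b)) \<le> artanh (cmod (g a)) + poincare_dist a b"
proof (cases "cmod (g a) \<le> cmod (g b)")
  case True
  have ga: "cmod (g a) < 1" and gb: "cmod (g b) < 1"
    using g a b by (auto simp: image_subset_iff)
  have "cmod (g a) * cmod (g b) < 1"
    using ga gb mult_mono[of "cmod (g a)" 1 "cmod (g b)" "cmod (g b)"] by auto
  then have "0 \<le> (cmod (g b) - cmod (g a)) / (1 - cmod (g a) * cmod (g b))"
    using True by simp
  then have "artanh ((cmod (g b) - cmod (g a)) / (1 - cmod (g a) * cmod (g b)))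
      \<le> artanh (cmod (Moebius_function 0 b a))"
    using cmod_Moebius_function_lower[OF ga gb True] Schwarz_Pick[OF hol g, of a b]
      Moebius_function_norm_lt_1[of b a 0] a b
    by (intro artanh_real_mono) auto
  then show ?thesis
    using artanh_diff_real[of "cmod (g a)" "cmod (g b)"] True gb by (simp add: poincare_dist_Moebius)
next
  case False
  have "artanh (cmod (g b)) \<le> artanh (cmod (g a))"
    using False g a by (intro artanh_real_mono) (auto simp: image_subset_iff intro: less_le_trans[of _ 0])
  then show ?thesis
    using poincare_dist_nonneg[OF a b] by linarith
qed

text \<open>Names membership in the set under the infimum of \<open>kobayashi_from_discs\<close>.
  Explicit chains give upper bounds, and exhibiting one also shows that the infimum is taken over a
  nonempty set.\<close>

definition disc_chain :: "(complex \<Rightarrow> 'a) set \<Rightarrow> 'a \<Rightarrow> 'a \<Rightarrow> real \<Rightarrow> bool" where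
  "disc_chain H x y L \<longleftrightarrow>
     (\<exists>m p f a b.
        p 0 = x \<and> p m = y \<and>
        (\<forall>j<m. f j \<in> H \<and> a j \<in> ball 0 1 \<and> b j \<in> ball 0 1 \<and>
               f j (a j) = p j \<and> f j (b j) = p (Suc j)) \<and>
        L = (\<Sum>j<(m::nat). poincare_dist (a j) (b j)))"

lemma kobayashi_from_discs_eq: "kobayashi_from_discs H x y = Inf {L. disc_chain H x y L}"
  by (simp add: kobayashi_from_discs_def disc_chain_def)

lemma disc_chain_refl: "disc_chain H x x 0"
  unfolding disc_chain_def by (rule exI[of _ 0]) auto

lemma disc_chain_snoc:
  assumes "disc_chain H x y L" and "f \<in> H" "a \<in> ball 0 1" "b \<in> ball 0 1" "f a = y" "f b = z"
  shows "disc_chain H x z (L + poincare_dist a b)"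
proof -
  obtain m p g c d where "p 0 = x" "p m = y"
    and g: "\<And>j. j < m \<Longrightarrow> g j \<in> H \<and> c j \<in> ball 0 1 \<and> d j \<in> ball 0 1 \<and>
               g j (c j) = p j \<and> g j (d j) = p (Suc j)"
    and L: "L = (\<Sum>j<(m::nat). poincare_dist (c j) (d j))"
    using assms(1) unfolding disc_chain_def by blast
  have "(\<Sum>j<Suc m. poincare_dist ((c(m := a)) j) ((d(m := b)) j)) = L + poincare_dist a b"
    using L by simp
  then show ?thesis
    unfolding disc_chain_def
    using g assms(2-) \<open>p 0 = x\<close> \<open>p m = y\<close>
    by (intro exI[of _ "Suc m"] exI[of _ "p(Suc m := z)"] exI[of _ "g(m := f)"]
        exI[of _ "c(m := a)"] exI[of _ "d(m := b)"]) (auto simp: less_Suc_eq)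
qed

lemma disc_chain_single:
  assumes "f \<in> H" "a \<in> ball 0 1" "b \<in> ball 0 1" "f a = x" "f b = y"
  shows "disc_chain H x y (poincare_dist a b)"
  using disc_chain_snoc[OF disc_chain_refl assms] by simp

lemma disc_chain_nonneg: "disc_chain H x y L \<Longrightarrow> 0 \<le> L"
  unfolding disc_chain_def by (auto intro!: sum_nonneg poincare_dist_nonneg)

lemma kobayashi_from_discs_le:
  assumes "disc_chain H x y L"
  shows "kobayashi_from_discs H x y \<le> L"
  unfolding kobayashi_from_discs_eq using assms
  by (intro cInf_lower bdd_belowI[of _ 0]) (auto dest: disc_chain_nonneg)

text \<open>The quantity \<open>artanh (cmod (\<Phi> p))\<close> starts at \<open>0\<close> and
  grows along each link of a chain by at most the length of that link. The assumption
  \<open>ex\<close> keeps the infimum meaningful.\<close>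

lemma artanh_le_kobayashi_from_discs:
  assumes \<Phi>: "\<And>f. f \<in> H \<Longrightarrow> (\<Phi> \<circ> f) holomorphic_on ball 0 1 \<and> (\<Phi> \<circ> f) ` ball 0 1 \<subseteq> ball 0 1"
    and x: "\<Phi> x = 0" and ex: "disc_chain H x y L"
  shows "artanh (cmod (\<Phi> y)) \<le> kobayashi_from_discs H x y"
  unfolding kobayashi_from_discs_eq
proof (rule cInf_greatest)
  show "{L. disc_chain H x y L} \<noteq> {}"
    using ex by auto
next
  fix L assume "L \<in> {L. disc_chain H x y L}"
  then obtain m p g c d where "p 0 = x" "p m = y"
    and g: "\<And>j. j < m \<Longrightarrow> g j \<in> H \<and> c j \<in> ball 0 1 \<and> d j \<in> ball 0 1 \<and>
               g j (c j) = p j \<and> g j (d j) = p (Suc j)"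
    and L: "L = (\<Sum>j<(m::nat). poincare_dist (c j) (d j))"
    unfolding disc_chain_def by blast
  have "artanh (cmod (\<Phi> (p k))) \<le> (\<Sum>j<k. poincare_dist (c j) (d j))" if "k \<le> m" for k
    using that
  proof (induction k)
    case 0
    then show ?case
      using x \<open>p 0 = x\<close> by simp
  next
    case (Suc k)
    then have "artanh (cmod ((\<Phi> \<circ> g k) (d k))) \<le> artanh (cmod ((\<Phi> \<circ> g k) (c k))) + poincare_dist (c k) (d k)"
      using g[of k] \<Phi>[of "g k"] by (intro artanh_cmod_le_poincare_dist) (auto simp: comp_def)
    then show ?case
      using Suc g[of k] by (simp add: comp_def)
  qed
  then show "artanh (cmod (\<Phi> y)) \<le> L"
    using \<open>p m = y\<close> L by blast
qed

lemma kobayashi_dist_disc_le: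
  assumes "z \<in> ball 0 1" "w \<in> ball 0 1"
  shows "kobayashi_dist_disc z w \<le> poincare_dist z w"
  unfolding kobayashi_dist_disc_def
  using assms by (intro kobayashi_from_discs_le disc_chain_single[of "\<lambda>z. z"]) auto

lemma artanh_cmod_le_kobayashi_dist_disc:
  assumes "z \<in> ball 0 1"
  shows "artanh (cmod z) \<le> kobayashi_dist_disc 0 z"
  unfolding kobayashi_dist_disc_def
proof (rule artanh_le_kobayashi_from_discs[where \<Phi> = "\<lambda>z. z"])
  show "disc_chain {f. f holomorphic_on ball 0 1 \<and> f ` ball 0 1 \<subseteq> ball 0 1} 0 z (poincare_dist 0 z)"
    using assms by (intro disc_chain_single[of "\<lambda>z. z"]) auto
qed (auto simp: comp_def)

text \<open>The points \<open>0\<close>, \<open>t * z\<close> and \<open>z\<close> lie on one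
  hyperbolic geodesic, so the distances subtract exactly. This equality is what later isolates a
  bound on \<open>artanh (t * cmod z)\<close>.\<close>

lemma poincare_dist_collinear:
  assumes "z \<in> ball 0 1" "0 \<le> t" "t \<le> 1"
  shows "poincare_dist z (of_real t * z) = artanh (cmod z) - artanh (t * cmod z)"
proof -
  have "t * cmod z \<le> cmod z"
    using assms by (simp add: mult_left_le_one_le)
  have "t * (cmod z)\<^sup>2 < 1"
    using assms mult_mono[of t 1 "(cmod z)\<^sup>2" "(cmod z)\<^sup>2"] abs_square_less_1[of "cmod z"] by auto
  moreover have "1 - cnj (of_real t * z) * z = of_real (1 - t * (cmod z)\<^sup>2)"
    by (simp add: complex_norm_square[symmetric] mult.assoc mult.commute[of "cnj z"] del: of_real_power)
  moreover have "z - of_real t * z = of_real (1 - t) * z"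
    by (simp add: algebra_simps)
  ultimately have "cmod ((z - of_real t * z) / (1 - cnj (of_real t * z) * z))
      = (1 - t) * cmod z / (1 - t * (cmod z)\<^sup>2)"
    using assms by (simp only: norm_divide norm_mult norm_of_real) simp
  also have "\<dots> = (cmod z - t * cmod z) / (1 - (t * cmod z) * cmod z)"
    by (simp add: power2_eq_square algebra_simps)
  finally show ?thesis
    using artanh_diff_real[of "t * cmod z" "cmod z"] assms \<open>t * cmod z \<le> cmod z\<close>
    by (simp add: poincare_dist_def)
qed

subsection \<open>Descending through a Dini cusp\<close>

lemma ln_one_minus_ge:
  fixes x :: real
  assumes "0 \<le> x" "x \<le> 1 / 2"
  shows "- 2 * x \<le> ln (1 - x)"
proof -
  have "x * x \<le> x * (1 / 2)"
    using assms by (intro mult_left_mono) auto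
  then show ?thesis
    using ln_one_minus_pos_lower_bound[OF assms] by (simp add: power2_eq_square)
qed

text \<open>Here \<open>u\<close> and \<open>v\<close> are the distances to the boundary point
  \<open>-1\<close>. In the half-plane tangent there the cost would be
  \<open>(ln u - ln v) / 2\<close>. The extra \<open>u / 2\<close> pays for the curvature of the
  circle, through \<open>ln (2 - v) - ln (2 - u) \<le> - ln (1 - u / 2) \<le> u\<close>.\<close>

lemma poincare_dist_near_minus_one_le:
  assumes "0 < v" "v \<le> u" "u \<le> 1"
  shows "poincare_dist (of_real (u - 1)) (of_real (v - 1)) \<le> (ln u - ln v) / 2 + u / 2"
proof -
  have "(complex_of_real (u - 1) - of_real (v - 1)) / (1 - cnj (of_real (v - 1)) * of_real (u - 1))
      = of_real (((1 - v) - (1 - u)) / (1 - (1 - u) * (1 - v)))"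
    by (simp add: algebra_simps)
  moreover have "0 \<le> ((1 - v) - (1 - u)) / (1 - (1 - u) * (1 - v))"
    using assms mult_mono[of "1 - u" 1 "1 - v" "1 - v"] by simp
  ultimately have "poincare_dist (of_real (u - 1)) (of_real (v - 1))
      = artanh (((1 - v) - (1 - u)) / (1 - (1 - u) * (1 - v)))"
    unfolding poincare_dist_def by (simp only: norm_of_real abs_of_nonneg)
  also have "\<dots> = artanh (1 - v) - artanh (1 - u)"
    using assms by (intro artanh_diff_real) auto
  also have "\<dots> = (ln (2 - v) - ln v - ln (2 - u) + ln u) / 2"
    using assms by (simp add: artanh_real_eq diff_divide_distrib add_divide_distrib)
  finally have "poincare_dist (of_real (u - 1)) (of_real (v - 1))
      = (ln (2 - v) - ln v - ln (2 - u) + ln u) / 2" .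
  moreover have "ln (2 - v) \<le> ln 2"
    using assms by simp
  moreover have "ln (2 - u) = ln 2 + ln (1 - u / 2)"
    using ln_mult[of 2 "1 - u / 2"] assms by (simp add: algebra_simps)
  moreover have "- u \<le> ln (1 - u / 2)"
    using ln_one_minus_ge[of "u / 2"] assms by simp
  ultimately show ?thesis
    by (simp add: field_simps)
qed

text \<open>
  The disc has radius \<open>R\<close> and bottom height \<open>h = R * s\<^sup>2 / 2\<close>. Moving down its diameter from height \<open>a = R * s\<close>
  to \<open>d\<close> costs more than in a half-plane only by terms of order \<open>a / R\<close> and \<open>h / d\<close>, both of order \<open>s\<close>.
\<close>

lemma disc_chain_descend_step:
  assumes chain: "disc_chain H x (l (of_real (R * s))) L"
    and H: "(\<lambda>z. l (of_real (R * s\<^sup>2 / 2 + R) + of_real R * z)) \<in> H"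
    and s: "0 < s" "s \<le> 1 / 4" and R: "0 < R"
    and d: "R * s / 4 \<le> d" "d \<le> R * s"
  shows "\<exists>M. disc_chain H x (l (of_real d)) M \<and> M \<le> L + (ln (R * s) - ln d) / 2 + 5 / 2 * s"
proof -
  define h where "h = R * s\<^sup>2 / 2"
  have d0: "0 < d"
    using d s R by (meson divide_pos_pos less_le_trans mult_pos_pos zero_less_numeral)
  have hd: "h \<le> 2 * s * d"
  proof -
    have "2 * s * (R * s / 4) \<le> 2 * s * d"
      using d s by (intro mult_left_mono) auto
    then show ?thesis
      by (simp add: h_def power2_eq_square algebra_simps)
  qed
  have "2 * s * d \<le> 1 / 2 * d"
    using s d0 by (intro mult_right_mono) auto
  then have h2: "h \<le> d / 2"
    using hd by simp
  have h0: "0 \<le> h"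
    using R by (simp add: h_def)
  \<comment> \<open>Height \<open>w + h\<close> has coordinate \<open>w / R - 1\<close> once the
    disc is rescaled to the unit disc. So \<open>u\<close> and \<open>v\<close> are the rescaled
    heights of the two points above the bottom of the disc.\<close>
  define u where "u = (R * s - h) / R"
  define v where "v = (d - h) / R"
  have v: "0 < v" "v \<le> u"
    using h2 d0 R d by (auto simp: u_def v_def divide_right_mono)
  have us: "u \<le> s"
    using R h0 by (simp add: u_def field_simps)
  have "ln u - ln v = ln (R * s - h) - ln (d - h)"
    using R h2 d d0 by (simp add: u_def v_def ln_div)
  also have "ln (d - h) = ln d + ln (1 - h / d)"
    using ln_mult[of d "1 - h / d"] d0 h2 by (simp add: algebra_simps)
  also have "ln (R * s - h) - (ln d + ln (1 - h / d)) \<le> ln (R * s) - (ln d + - 2 * (h / d))"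
    using h0 h2 d0 d by (intro diff_mono add_left_mono ln_one_minus_ge) (auto simp: field_simps)
  also have "\<dots> \<le> ln (R * s) - ln d + 4 * s"
    using hd d0 by (simp add: field_simps)
  finally have uv: "ln u - ln v \<le> ln (R * s) - ln d + 4 * s" .
  have eq: "of_real (R * s\<^sup>2 / 2 + R) + complex_of_real R * of_real (w / R - 1) = of_real (w + h)" for w
    unfolding of_real_mult[symmetric] of_real_add[symmetric] of_real_eq_iff
    using R by (simp add: h_def field_simps)
  have "disc_chain H x (l (of_real d)) (L + poincare_dist (of_real (u - 1)) (of_real (v - 1)))"
    by (rule disc_chain_snoc[OF chain H])
      (use v us s eq[of "R * s - h"] eq[of "d - h"] in \<open>auto simp: u_def v_def simp del: of_real_diff of_real_divide\<close>)
  moreover have "poincare_dist (of_real (u - 1)) (of_real (v - 1)) \<le> (ln u - ln v) / 2 + u / 2"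
    using v us s by (intro poincare_dist_near_minus_one_le) auto
  \<comment> \<open>Half of the error in \<open>uv\<close> is \<open>2 * s\<close>, and
    \<open>u / 2\<close> adds at most \<open>s / 2\<close>, whence the factor
    \<open>5 / 2\<close>.\<close>
  moreover from this have "L + poincare_dist (of_real (u - 1)) (of_real (v - 1)) \<le> L + (ln (R * s) - ln d) / 2 + 5 / 2 * s"
    using uv us by argo
  ultimately show ?thesis
    by blast
qed

text \<open>The single steps are iterated through the heights \<open>a j = R / 2 ^ j * s j\<close>.
  The logarithms telescope and the errors add up to at most \<open>5 / 2 * S\<close>. Consecutive
  heights have ratio at least \<open>1 / 4\<close>, as each step requires, and at most
  \<open>1 / 2\<close>, so they tend to \<open>0\<close>.\<close>

lemma disc_chain_descend:
  fixes s :: "nat \<Rightarrow> real"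
  assumes chain: "disc_chain H x (l (of_real (R * s 0))) L"
    and H: "\<And>j. (\<lambda>z. l (of_real (R / 2 ^ j * (s j)\<^sup>2 / 2 + R / 2 ^ j) + of_real (R / 2 ^ j) * z)) \<in> H"
    and s: "\<And>j. 0 < s j" "\<And>j. s j \<le> 1 / 4" and R: "0 < R"
    and s_Suc: "\<And>j. s j / 2 \<le> s (Suc j)" "\<And>j. s (Suc j) \<le> s j"
    and S: "\<And>j. (\<Sum>i<j. s i) \<le> S"
    and d: "0 < d" "d \<le> R * s 0"
  shows "\<exists>M. disc_chain H x (l (of_real d)) M \<and> M \<le> L + (ln (R * s 0) - ln d) / 2 + 5 / 2 * S"
proof -
  define a where "a j = R / 2 ^ j * s j" for j
  have a_pos: "0 < a j" for j
    using s R by (simp add: a_def)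
  have a_Suc: "a j / 4 \<le> a (Suc j)" "a (Suc j) \<le> a j / 2" for j
    using mult_left_mono[OF s_Suc(1)[of j], of "R / 2 ^ Suc j"] mult_left_mono[OF s_Suc(2)[of j], of "R / 2 ^ Suc j"] R
    by (simp_all add: a_def)
  have a_le: "a j \<le> a 0 / 2 ^ j" for j
  proof (induction j)
    case (Suc j)
    then show ?case
      using a_Suc(2)[of j] by simp
  qed simp
  have A: "\<exists>M. disc_chain H x (l (of_real (a j))) M \<and> M \<le> L + (ln (a 0) - ln (a j)) / 2 + 5 / 2 * (\<Sum>i<j. s i)" for j
  proof (induction j)
    case 0
    then show ?case
      using chain by (auto simp: a_def)
  next
    case (Suc j)
    then obtain M where M: "disc_chain H x (l (of_real (a j))) M"
      "M \<le> L + (ln (a 0) - ln (a j)) / 2 + 5 / 2 * (\<Sum>i<j. s i)" by blast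
    have "\<exists>M'. disc_chain H x (l (of_real (a (Suc j)))) M' \<and> M' \<le> M + (ln (a j) - ln (a (Suc j))) / 2 + 5 / 2 * s j"
      using disc_chain_descend_step[OF M(1)[unfolded a_def] H[of j] s(1)[of j] s(2)[of j], of "a (Suc j)"]
        R a_Suc[of j] a_pos[of j] by (auto simp: a_def)
    then show ?case
      using M(2) by (fastforce simp: field_simps)
  qed
  obtain n where "(1 / 2) ^ n < d / a 0"
    using real_arch_pow_inv[of "d / a 0" "1 / 2"] d a_pos by auto
  then have "a 0 / 2 ^ n < d"
    using a_pos[of 0] by (simp add: field_simps)
  then have "a n < d"
    using a_le[of n] by linarith
  then have ex: "\<exists>n. a n < d" ..
  \<comment> \<open>The last disc leads from the lowest height not below \<open>d\<close> straight
    to \<open>d\<close>. That step is admissible because \<open>a j / 4 \<le> a (Suc j) < d\<close>,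
    and \<open>d \<le> a 0\<close> rules out \<open>n = 0\<close>.\<close>
  define n where "n = (LEAST n. a n < d)"
  have n: "a n < d"
    unfolding n_def using ex by (rule LeastI_ex)
  have "a 0 = R * s 0"
    by (simp add: a_def)
  then obtain j where j: "n = Suc j"
    using n d by (cases n) auto
  have "d \<le> a j"
    using not_less_Least[of j "\<lambda>n. a n < d"] j by (simp add: n_def)
  obtain M where M: "disc_chain H x (l (of_real (a j))) M"
      "M \<le> L + (ln (a 0) - ln (a j)) / 2 + 5 / 2 * (\<Sum>i<j. s i)" using A by blast
  have "\<exists>M'. disc_chain H x (l (of_real d)) M' \<and> M' \<le> M + (ln (a j) - ln d) / 2 + 5 / 2 * s j"
    using disc_chain_descend_step[OF M(1)[unfolded a_def] H[of j] s(1)[of j] s(2)[of j], of d]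
      R a_Suc(1)[of j] n j \<open>d \<le> a j\<close> by (auto simp: a_def)
  then obtain M' where M': "disc_chain H x (l (of_real d)) M'" "M' \<le> M + (ln (a j) - ln d) / 2 + 5 / 2 * s j"
    by blast
  moreover have "M' \<le> L + (ln (R * s 0) - ln d) / 2 + 5 / 2 * S"
    using M(2) M'(2) S[of "Suc j"] \<open>a 0 = R * s 0\<close> by (simp add: field_simps)
  ultimately show ?thesis
    by blast
qed

text \<open>An integral test on dyadic intervals. By monotonicity \<open>\<omega> t / t\<close> is
  at least \<open>c j\<close> on \<open>I j\<close>, with the numerator taken at the left end and
  the denominator at the right end. Multiplied by the length of \<open>I j\<close> this gives half
  of \<open>\<omega> (R / 2 ^ Suc j)\<close>.\<close>

lemma Dini_sequence_sum_le:
  fixes \<omega> :: "real \<Rightarrow> real"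
  assumes dini: "dini_condition (2 * r) \<omega>" and mono: "mono_on {0..<2 * r} \<omega>"
    and R: "0 < R" "R < 2 * r"
  shows "\<exists>W. \<forall>n. (\<Sum>j<n. \<omega> (R / 2 ^ Suc j)) \<le> W"
proof -
  define I where "I j = {R / 2 ^ Suc j<..R / 2 ^ j}" for j :: nat
  define c where "c j = \<omega> (R / 2 ^ Suc j) / (R / 2 ^ j)" for j :: nat
  have nn: "0 \<le> \<omega> t" if "0 \<le> t" "t < 2 * r" for t
    using dini that by (auto simp: dini_condition_def image_subset_iff)
  have R2: "R / 2 ^ j \<le> R" for j :: nat
    using R by (simp add: field_simps)
  have R_lt: "R / 2 ^ j < 2 * r" for j :: nat
    using R R2[of j] by linarith
  have c_nn: "0 \<le> c j" for j
    using nn[of "R / 2 ^ Suc j"] R_lt[of "Suc j"] R by (simp add: c_def)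
  have disj: "i = j" if "t \<in> I i" "t \<in> I j" for i j t
  proof (rule ccontr)
    assume "i \<noteq> j"
    moreover have "False" if "i < j" "t \<in> I i" "t \<in> I j" for i j
    proof -
      have "R / 2 ^ j \<le> R / 2 ^ Suc i"
        using \<open>i < j\<close> R by (intro divide_left_mono power_increasing) auto
      then show False
        using that by (auto simp: I_def)
    qed
    ultimately show False
      using that by (metis linorder_neqE_nat)
  qed
  \<comment> \<open>The intervals are disjoint, so at most one summand is nonzero at
    \<open>t\<close>.\<close>
  have pt: "(\<Sum>j<n. ennreal (c j) * indicator (I j) t) \<le> ennreal (\<omega> t / t) * indicator {0<..<2 * r} t" for n t
  proof (cases "\<exists>k<n. t \<in> I k")
    case True
    then obtain k where k: "k < n" "t \<in> I k" by blast
    have t: "R / 2 ^ Suc k < t" "t \<le> R / 2 ^ k"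
      using k by (auto simp: I_def)
    have t0: "0 < t"
      using t(1) R by (meson divide_pos_pos less_trans zero_less_numeral zero_less_power)
    have t2: "t < 2 * r"
      using t(2) R_lt[of k] by linarith
    have "(\<Sum>j<n. ennreal (c j) * indicator (I j) t) = (\<Sum>j<n. if j = k then ennreal (c k) else 0)"
      using disj k by (intro sum.cong) (auto simp: indicator_def)
    also have "\<dots> = ennreal (c k)"
      using k by simp
    also have "\<dots> \<le> ennreal (\<omega> t / t)"
    proof (intro ennreal_leI)
      have "\<omega> (R / 2 ^ Suc k) \<le> \<omega> t"
        using t t0 t2 R R_lt[of "Suc k"] by (intro mono_onD[OF mono]) auto
      then show "c k \<le> \<omega> t / t"
        unfolding c_def using t t0 t2 nn by (intro frac_le) auto
    qed
    finally show ?thesis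
      using t0 t2 by simp
  next
    case False
    then show ?thesis
      by (auto intro: sum.neutral)
  qed
  have sum_eq: "(\<integral>\<^sup>+ t. (\<Sum>j<n. ennreal (c j) * indicator (I j) t) \<partial>lebesgue)
      = ennreal ((\<Sum>j<n. \<omega> (R / 2 ^ Suc j)) / 2)" for n
  proof -
    have "(\<integral>\<^sup>+ t. (\<Sum>j<n. ennreal (c j) * indicator (I j) t) \<partial>lebesgue)
        = (\<Sum>j<n. ennreal (c j) * emeasure lebesgue (I j))"
      by (subst nn_integral_sum) (auto simp: I_def nn_integral_cmult_indicator
          intro!: borel_measurable_times_ennreal borel_measurable_indicator)
    also have "\<dots> = (\<Sum>j<n. ennreal (\<omega> (R / 2 ^ Suc j) / 2))"
    proof (intro sum.cong refl)
      fix j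
      have "emeasure lebesgue (I j) = ennreal (R / 2 ^ j - R / 2 ^ Suc j)"
        using R by (simp add: I_def field_simps)
      then have "ennreal (c j) * emeasure lebesgue (I j) = ennreal (c j * (R / 2 ^ j - R / 2 ^ Suc j))"
        using c_nn[of j] R by (simp only: ennreal_mult')
      also have "c j * (R / 2 ^ j - R / 2 ^ Suc j) = \<omega> (R / 2 ^ Suc j) / 2"
        using R by (simp add: c_def field_simps)
      finally show "ennreal (c j) * emeasure lebesgue (I j) = ennreal (\<omega> (R / 2 ^ Suc j) / 2)" .
    qed
    also have "\<dots> = ennreal ((\<Sum>j<n. \<omega> (R / 2 ^ Suc j)) / 2)"
      using nn R R_lt by (subst sum_ennreal) (auto simp: sum_divide_distrib simp del: power_Suc)
    finally show ?thesis .
  qed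
  define D where "D = (\<integral>\<^sup>+ t\<in>{0<..<2 * r}. ennreal (\<omega> t / t) \<partial>lebesgue)"
  have "D < \<infinity>"
    using dini by (simp add: D_def dini_condition_def)
  have "ennreal ((\<Sum>j<n. \<omega> (R / 2 ^ Suc j)) / 2) \<le> D" for n
    unfolding sum_eq[symmetric] D_def by (intro nn_integral_mono pt)
  then have "ennreal ((\<Sum>j<n. \<omega> (R / 2 ^ Suc j)) / 2) \<le> ennreal (enn2real D)" for n
    using \<open>D < \<infinity>\<close> by simp
  then have "(\<Sum>j<n. \<omega> (R / 2 ^ Suc j)) / 2 \<le> enn2real D" for n
    by (subst (asm) ennreal_le_iff) auto
  then have "(\<Sum>j<n. \<omega> (R / 2 ^ Suc j)) \<le> 2 * enn2real D" for n
    by (simp add: field_simps)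
  then show ?thesis
    by blast
qed

text \<open>
  The Dini condition makes \<open>\<omega> (R / 2 ^ j)\<close> summable. Replacing \<open>\<omega> (R / 2 ^ j) / c\<close> by the larger
  averages \<open>s (Suc j) = (s j + \<omega> (R / 2 ^ Suc j) / c) / 2\<close> keeps it summable and prevents \<open>s\<close> from
  dropping by more than a factor of two at each step.
\<close>

lemma Dini_scales:
  fixes \<omega> :: "real \<Rightarrow> real"
  assumes dini: "dini_condition (2 * r) \<omega>" and mono: "mono_on {0..<2 * r} \<omega>"
    and cont: "continuous (at 0 within {0..<2 * r}) \<omega>" and \<omega>0: "\<omega> 0 = 0"
    and c: "0 < c" and r0: "0 < r0"
  obtains R s S where "0 < R" "R < r0" "R < 2 * r"
    "\<And>j. 0 < s j" "\<And>j. s j \<le> 1 / 4"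
    "\<And>j. s j / 2 \<le> s (Suc j)" "\<And>j. s (Suc j) \<le> s j"
    "\<And>j::nat. \<omega> (R / 2 ^ j) \<le> c * s j" "\<And>j. (\<Sum>i<j. s i) \<le> S"
proof -
  have r: "0 < r"
    using dini by (simp add: dini_condition_def)
  obtain d where d: "0 < d" "\<And>t. t \<in> {0..<2 * r} \<Longrightarrow> dist t 0 < d \<Longrightarrow> dist (\<omega> t) (\<omega> 0) < c / 4"
    using cont c unfolding continuous_within_eps_delta by (metis zero_less_divide_iff zero_less_numeral)
  \<comment> \<open>Having \<open>R < d\<close> forces \<open>\<omega> R < c / 4\<close>, which
    starts the induction \<open>dom\<close> at \<open>s 0 = 1 / 4\<close>.\<close>
  define R where "R = min (min d r0) r / 2"
  have R: "0 < R" "R < r0" "R < 2 * r" "R < d"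
    using d r0 r by (auto simp: R_def)
  have nn: "0 \<le> \<omega> t" if "0 \<le> t" "t < 2 * r" for t
    using dini that by (auto simp: dini_condition_def image_subset_iff)
  have R_le: "0 \<le> R / 2 ^ j" "R / 2 ^ j < 2 * r" for j :: nat
  proof -
    have "R / 2 ^ j \<le> R"
      using R by (simp add: field_simps)
    then show "0 \<le> R / 2 ^ j" "R / 2 ^ j < 2 * r"
      using R by auto
  qed
  have \<omega>_nn: "0 \<le> \<omega> (R / 2 ^ j)" for j :: nat
    using nn R_le by blast
  define s where "s = rec_nat (1 / 4) (\<lambda>j x. (x + \<omega> (R / 2 ^ Suc j) / c) / 2)"
  have s0: "s 0 = 1 / 4" and sS: "s (Suc j) = (s j + \<omega> (R / 2 ^ Suc j) / c) / 2" for j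
    by (simp_all add: s_def)
  have \<omega>_Suc: "\<omega> (R / 2 ^ Suc j) / c \<le> \<omega> (R / 2 ^ j) / c" for j
    using R R_le[of j] R_le[of "Suc j"] c by (intro divide_right_mono mono_onD[OF mono]) (auto simp: field_simps)
  have dom: "\<omega> (R / 2 ^ j) / c \<le> s j" for j
  proof (induction j)
    case 0
    then show ?case
      using d(2)[of R] R \<omega>0 \<omega>_nn[of 0] c by (simp add: s0 dist_real_def field_simps)
  next
    case (Suc j)
    then show ?case
      using \<omega>_Suc[of j] unfolding sS by argo
  qed
  have s_pos: "0 < s j" for j
  proof (induction j)
    case (Suc j)
    then show ?case
      using \<omega>_nn[of "Suc j"] c by (simp add: sS add_pos_nonneg)
  qed (simp add: s0)
  have half: "s j / 2 \<le> s (Suc j)" for j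
    using \<omega>_nn[of "Suc j"] c by (simp add: sS)
  have decr: "s (Suc j) \<le> s j" for j
    using dom[of j] \<omega>_Suc[of j] unfolding sS by argo
  have quarter: "s j \<le> 1 / 4" for j
  proof (induction j)
    case (Suc j)
    then show ?case
      using decr[of j] by simp
  qed (simp add: s0)
  obtain W where W: "\<And>n. (\<Sum>j<n. \<omega> (R / 2 ^ Suc j)) \<le> W"
    using Dini_sequence_sum_le[OF dini mono R(1) R(3)] by blast
  \<comment> \<open>The recurrence
    \<open>2 * s (Suc i) = s i + \<omega> (R / 2 ^ Suc i) / c\<close>, summed over
    \<open>i\<close>.\<close>
  have "(\<Sum>i<n. s i) + 2 * s n = 1 / 2 + (\<Sum>i<n. \<omega> (R / 2 ^ Suc i)) / c" for n
    by (induction n) (simp_all add: s0 sS add_divide_distrib del: power_Suc)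
  moreover have "(\<Sum>i<n. \<omega> (R / 2 ^ Suc i)) / c \<le> W / c" for n
    using W c by (intro divide_right_mono) auto
  ultimately have S: "(\<Sum>i<n. s i) \<le> 1 / 2 + W / c" for n
    using s_pos[of n] by (smt (verit))
  have dom': "\<omega> (R / 2 ^ j) \<le> c * s j" for j
    using dom[of j] c by (simp add: field_simps)
  show ?thesis
    by (rule that[of R s "1 / 2 + W / c"]) (fact R s_pos quarter half decr dom' S)+
qed

text \<open>Lifting the disc by \<open>R * s\<^sup>2 / 2\<close> makes the estimate close:
  \<open>y\<^sup>2 / 2 < 1 + x\<close> in the unit disc, so the arithmetic-geometric mean inequality
  gives \<open>a > R * (s * \<bar>y\<bar>) = s * \<bar>b\<bar>\<close>, while
  \<open>\<omega> \<bar>b\<bar> \<le> \<omega> R \<le> c * s\<close>.\<close>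

lemma cusp_contains_disc:
  fixes \<omega> :: "real \<Rightarrow> real"
  assumes mono: "mono_on {0..<2 * r} \<omega>" and c: "0 < c"
    and R: "0 < R" "R < 2 * r" "4 * R \<le> r0" and s: "0 < s" "s \<le> 1 / 4"
    and \<omega>: "\<omega> R \<le> c * s" and xy: "x\<^sup>2 + y\<^sup>2 < 1"
  defines "a \<equiv> R * s\<^sup>2 / 2 + R + R * x" and "b \<equiv> R * y"
  shows "\<bar>b\<bar> < r0" "0 < a" "a < r0" "\<bar>b\<bar> * \<omega> \<bar>b\<bar> < c * a"
proof -
  have x: "\<bar>x\<bar> < 1" and y: "\<bar>y\<bar> < 1"
    using xy by (auto simp: abs_square_less_1[symmetric] intro: le_less_trans[rotated])
  have "(1 + x) * (1 - x) < (1 + x) * 2"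
    using x by (intro mult_strict_left_mono) auto
  then have x': "y\<^sup>2 / 2 < 1 + x"
    using xy by (simp add: power2_eq_square algebra_simps)
  have bR: "\<bar>b\<bar> < R"
    using y R by (simp add: b_def abs_mult)
  then show "\<bar>b\<bar> < r0"
    using R by linarith
  have "s\<^sup>2 < 1"
    using s by (simp add: abs_square_less_1)
  then have "R * s\<^sup>2 < R * 1"
    using R by (intro mult_strict_left_mono) auto
  moreover have "R * x < R * 1"
    using x R by (intro mult_strict_left_mono) auto
  ultimately show "a < r0"
    using R unfolding a_def by linarith
  have lower: "R * (s * \<bar>y\<bar>) < a"
  proof -
    have "0 \<le> (s - \<bar>y\<bar>)\<^sup>2"
      by simp
    then have "s * \<bar>y\<bar> \<le> s\<^sup>2 / 2 + y\<^sup>2 / 2"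
      by (simp add: power2_diff)
    also have "\<dots> < s\<^sup>2 / 2 + (1 + x)"
      using x' by simp
    finally have "R * (s * \<bar>y\<bar>) < R * (s\<^sup>2 / 2 + (1 + x))"
      using R by simp
    then show ?thesis
      by (simp add: a_def algebra_simps)
  qed
  moreover have "0 \<le> R * (s * \<bar>y\<bar>)"
    using R s by simp
  ultimately show "0 < a"
    by linarith
  have "\<bar>b\<bar> * \<omega> \<bar>b\<bar> \<le> \<bar>b\<bar> * \<omega> R"
    using bR R by (intro mult_left_mono mono_onD[OF mono]) auto
  also have "\<dots> \<le> \<bar>b\<bar> * (c * s)"
    using \<omega> by (intro mult_left_mono) auto
  also have "\<dots> = c * (R * (s * \<bar>y\<bar>))"
    using R by (simp add: b_def abs_mult)
  also have "\<dots> < c * a"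
    using lower c by simp
  finally show "\<bar>b\<bar> * \<omega> \<bar>b\<bar> < c * a" .
qed

subsection \<open>Normals and complex tangent spaces\<close>

lemma has_real_derivative_along_line:
  assumes "(f has_derivative f') (at (x + t *\<^sub>R v))"
  shows "((\<lambda>s. f (x + s *\<^sub>R v)) has_real_derivative f' v) (at t)"
proof -
  have "((\<lambda>s. x + s *\<^sub>R v) has_derivative (\<lambda>h. h *\<^sub>R v)) (at t)"
    by (auto intro!: derivative_eq_intros)
  then have "((\<lambda>s. f (x + s *\<^sub>R v)) has_derivative (\<lambda>h. f' (h *\<^sub>R v))) (at t)"
    using assms by (rule has_derivative_compose)
  moreover have "(\<lambda>h. f' (h *\<^sub>R v)) = (*) (f' v)"
    using assms by (simp add: fun_eq_iff linear_cmul[OF has_derivative_linear] mult.commute)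
  ultimately show ?thesis
    by (simp add: has_field_derivative_def)
qed

lemma defining_function_on_gradient:
  fixes \<Omega> :: "('a::euclidean_space) set"
  assumes "defining_function_on \<Omega> U \<rho>"
  obtains n where "continuous_on U n" "\<And>x. x \<in> U \<Longrightarrow> (\<rho> has_derivative (\<lambda>v. v \<bullet> n x)) (at x)"
    "\<And>x. x \<in> frontier \<Omega> \<inter> U \<Longrightarrow> n x \<noteq> 0"
proof -
  obtain f' where f': "\<And>x. x \<in> U \<Longrightarrow> (\<rho> has_derivative blinfun_apply (f' x)) (at x)"
    and cont: "continuous_on U f'"
    using assms by (auto simp: defining_function_on_def C1_on_def)
  define n where "n x = (\<Sum>b\<in>Basis. blinfun_apply (f' x) b *\<^sub>R b)" for x
  have eq: "blinfun_apply (f' x) v = v \<bullet> n x" for x v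
  proof -
    have "blinfun_apply (f' x) v = blinfun_apply (f' x) (\<Sum>b\<in>Basis. (v \<bullet> b) *\<^sub>R b)"
      by (simp add: euclidean_representation)
    also have "\<dots> = v \<bullet> n x"
      by (simp add: n_def blinfun.sum_right blinfun.scaleR_right inner_sum_right mult.commute)
    finally show ?thesis .
  qed
  have der: "(\<rho> has_derivative (\<lambda>v. v \<bullet> n x)) (at x)" if "x \<in> U" for x
    using f'[OF that] unfolding eq .
  show ?thesis
  proof
    show "continuous_on U n"
      unfolding n_def using cont by (intro continuous_intros)
    show "n x \<noteq> 0" if x: "x \<in> frontier \<Omega> \<inter> U" for x
    proof
      assume "n x = 0"
      then have "frechet_derivative \<rho> (at x) = (\<lambda>_. 0)"
        using frechet_derivative_at[OF der, of x] x by simp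
      then show False
        using assms x by (auto simp: defining_function_on_def)
    qed
  qed (fact der)
qed

lemma defining_function_on_eventually:
  assumes \<rho>: "defining_function_on \<Omega> U \<rho>" and x: "x \<in> frontier \<Omega>" "x \<in> U"
  obtains e :: real where "e > 0" "\<And>t. \<bar>t\<bar> < e \<Longrightarrow> x + t *\<^sub>R v \<in> \<Omega> \<longleftrightarrow> \<rho> (x + t *\<^sub>R v) < \<rho> x"
proof -
  have "open U"
    using \<rho> by (simp add: defining_function_on_def)
  then have "open ((\<lambda>t::real. x + t *\<^sub>R v) -` U)"
    by (intro open_vimage continuous_intros)
  moreover have "0 \<in> (\<lambda>t::real. x + t *\<^sub>R v) -` U"
    using x by simp
  ultimately obtain e where e: "e > 0" "\<And>t::real. dist t 0 < e \<Longrightarrow> t \<in> (\<lambda>t::real. x + t *\<^sub>R v) -` U"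
    unfolding open_dist by blast
  have "\<rho> x = 0"
    using \<rho> x by (auto simp: defining_function_on_def)
  moreover have "\<Omega> \<inter> U = {x\<in>U. \<rho> x < 0}"
    using \<rho> by (simp add: defining_function_on_def)
  ultimately have "x + t *\<^sub>R v \<in> \<Omega> \<longleftrightarrow> \<rho> (x + t *\<^sub>R v) < \<rho> x" if "\<bar>t\<bar> < e" for t
    using e(2)[of t] that by (auto simp: dist_real_def)
  then show ?thesis
    using that e(1) by blast
qed

lemma gradient_neg_imp_inside:
  assumes \<rho>: "defining_function_on \<Omega> U \<rho>" and x: "x \<in> frontier \<Omega>" "x \<in> U"
    and der: "(\<rho> has_derivative (\<lambda>v. v \<bullet> n)) (at x)" and v: "v \<bullet> n < 0"
  shows "\<exists>e>0. \<forall>t. 0 < t \<and> t < e \<longrightarrow> x + t *\<^sub>R v \<in> \<Omega>"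
proof -
  obtain e where e: "e > 0" "\<And>t. \<bar>t\<bar> < e \<Longrightarrow> x + t *\<^sub>R v \<in> \<Omega> \<longleftrightarrow> \<rho> (x + t *\<^sub>R v) < \<rho> x"
    using defining_function_on_eventually[OF \<rho> x] by metis
  have "((\<lambda>t. \<rho> (x + t *\<^sub>R v)) has_real_derivative v \<bullet> n) (at 0)"
    by (rule has_real_derivative_along_line) (simp add: der)
  from DERIV_neg_dec_right[OF this v]
  obtain d where d: "d > 0" "\<And>t. 0 < t \<Longrightarrow> t < d \<Longrightarrow> \<rho> (x + t *\<^sub>R v) < \<rho> x"
    by auto
  show ?thesis
    using d e by (intro exI[of _ "min d e"]) auto
qed

lemma gradient_pos_imp_outside:
  assumes \<rho>: "defining_function_on \<Omega> U \<rho>" and x: "x \<in> frontier \<Omega>" "x \<in> U"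
    and der: "(\<rho> has_derivative (\<lambda>v. v \<bullet> n)) (at x)" and v: "v \<bullet> n > 0"
  shows "\<exists>e>0. \<forall>t. 0 < t \<and> t < e \<longrightarrow> x + t *\<^sub>R v \<notin> \<Omega>"
proof -
  obtain e where e: "e > 0" "\<And>t. \<bar>t\<bar> < e \<Longrightarrow> x + t *\<^sub>R v \<in> \<Omega> \<longleftrightarrow> \<rho> (x + t *\<^sub>R v) < \<rho> x"
    using defining_function_on_eventually[OF \<rho> x] by metis
  have "((\<lambda>t. \<rho> (x + t *\<^sub>R v)) has_real_derivative v \<bullet> n) (at 0)"
    by (rule has_real_derivative_along_line) (simp add: der)
  from DERIV_pos_inc_right[OF this v]
  obtain d where d: "d > 0" "\<And>t. 0 < t \<Longrightarrow> t < d \<Longrightarrow> \<rho> x < \<rho> (x + t *\<^sub>R v)"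
    by auto
  have "x + t *\<^sub>R v \<notin> \<Omega>" if "0 < t" "t < min d e" for t
    using d(2)[of t] e(2)[of t] that by simp
  then show ?thesis
    using d e by (intro exI[of _ "min d e"]) auto
qed

text \<open>All local defining functions must give the same hyperplane. If \<open>w\<close> were
  tangent for \<open>\<rho>'\<close> but outward for \<open>\<rho>\<close>, tilting it slightly
  against \<open>n'\<close> would give a direction that enters the domain according to
  \<open>\<rho>'\<close> and leaves it according to \<open>\<rho>\<close>.\<close>

lemma tangent_space_eq:
  fixes \<Omega> :: "('a::euclidean_space) set"
  assumes \<rho>: "defining_function_on \<Omega> U \<rho>" and x: "x \<in> frontier \<Omega>" "x \<in> U"
    and der: "(\<rho> has_derivative (\<lambda>v. v \<bullet> n)) (at x)"
  shows "tangent_space \<Omega> x = {v. v \<bullet> n = 0}"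
proof
  show "{v. v \<bullet> n = 0} \<subseteq> tangent_space \<Omega> x"
    using \<rho> x(2) unfolding tangent_space_def frechet_derivative_at[OF der, symmetric]
    by (auto intro!: exI[of _ U] exI[of _ \<rho>] simp: frechet_derivative_at[OF der, symmetric])
next
  show "tangent_space \<Omega> x \<subseteq> {v. v \<bullet> n = 0}"
  proof
    fix v assume "v \<in> tangent_space \<Omega> x"
    then obtain U' \<rho>' where \<rho>': "x \<in> U'" "defining_function_on \<Omega> U' \<rho>'"
      and v: "frechet_derivative \<rho>' (at x) v = 0"
      by (auto simp: tangent_space_def)
    obtain n' where n': "(\<rho>' has_derivative (\<lambda>v. v \<bullet> n')) (at x)" "n' \<noteq> 0"
      using defining_function_on_gradient[OF \<rho>'(2)] \<rho>'(1) x(1) by (metis IntI)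
    have v': "v \<bullet> n' = 0"
      using v frechet_derivative_at[OF n'(1)] by metis
    have False if w: "w \<bullet> n' = 0" "w \<bullet> n > 0" for w
    proof -
      \<comment> \<open>Chosen so that \<open>s * (\<bar>n' \<bullet> n\<bar> + 1)\<close> is half
        of \<open>w \<bullet> n\<close>: the tilt cannot destroy positivity against
        \<open>n\<close>.\<close>
      define s where "s = w \<bullet> n / (2 * (\<bar>n' \<bullet> n\<bar> + 1))"
      have s: "s > 0"
        using w by (simp add: s_def add_nonneg_pos)
      have "s * (n' \<bullet> n) \<le> s * (\<bar>n' \<bullet> n\<bar> + 1)"
        using s by (intro mult_left_mono) auto
      also have "\<dots> = w \<bullet> n / 2"
        by (simp add: s_def field_simps)
      finally have "(w - s *\<^sub>R n') \<bullet> n > 0"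
        using w by (simp add: inner_diff_left)
      moreover have "(w - s *\<^sub>R n') \<bullet> n' < 0"
        using w s n'(2) by (simp add: inner_diff_left)
      ultimately obtain e e' where "e > 0" "e' > 0"
        and "\<And>t. 0 < t \<Longrightarrow> t < e \<Longrightarrow> x + t *\<^sub>R (w - s *\<^sub>R n') \<in> \<Omega>"
        and "\<And>t. 0 < t \<Longrightarrow> t < e' \<Longrightarrow> x + t *\<^sub>R (w - s *\<^sub>R n') \<notin> \<Omega>"
        using gradient_neg_imp_inside[OF \<rho>'(2) x(1) \<rho>'(1) n'(1)] gradient_pos_imp_outside[OF \<rho> x der]
        by metis
      then show False
        using dense[of 0 "min e e'"] by auto
    qed
    from this[of v] this[of "- v"] v' show "v \<in> {v. v \<bullet> n = 0}"
      by force
  qed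
qed

text \<open>A vector orthogonal to the kernel of the derivative is a multiple of \<open>n\<close>.
  Unit length fixes the modulus of the factor, and a positive factor would point out of the
  domain.\<close>

lemma inward_unit_normal_eq:
  fixes \<Omega> :: "('a::euclidean_space) set"
  assumes \<rho>: "defining_function_on \<Omega> U \<rho>" and x: "x \<in> frontier \<Omega>" "x \<in> U"
    and der: "(\<rho> has_derivative (\<lambda>v. v \<bullet> n)) (at x)" and n: "n \<noteq> 0"
  shows "inward_unit_normal \<Omega> x = - (n /\<^sub>R norm n)"
  unfolding inward_unit_normal_def tangent_space_eq[OF assms(1-4)]
proof (rule the_equality)
  have "- (n /\<^sub>R norm n) \<bullet> n < 0"
    using n by simp
  from gradient_neg_imp_inside[OF assms(1-4) this]
  have "\<exists>\<epsilon>>0. \<forall>t. 0 < t \<and> t < \<epsilon> \<longrightarrow> x + t *\<^sub>R - (n /\<^sub>R norm n) \<in> \<Omega>" .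
  moreover have "norm (- (n /\<^sub>R norm n)) = 1"
    using n by simp
  moreover have "- (n /\<^sub>R norm n) \<bullet> v = 0" if "v \<bullet> n = 0" for v
    using that by (metis inner_commute inner_minus_right inner_scaleR_right mult_zero_right neg_0_equal_iff_equal)
  ultimately show "norm (- (n /\<^sub>R norm n)) = 1 \<and> (\<forall>v\<in>{v. v \<bullet> n = 0}. - (n /\<^sub>R norm n) \<bullet> v = 0) \<and>
      (\<exists>\<epsilon>>0. \<forall>t. 0 < t \<and> t < \<epsilon> \<longrightarrow> x + t *\<^sub>R - (n /\<^sub>R norm n) \<in> \<Omega>)"
    by blast
next
  fix \<eta> assume \<eta>: "norm \<eta> = 1 \<and> (\<forall>v\<in>{v. v \<bullet> n = 0}. \<eta> \<bullet> v = 0) \<and>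
      (\<exists>\<epsilon>>0. \<forall>t. 0 < t \<and> t < \<epsilon> \<longrightarrow> x + t *\<^sub>R \<eta> \<in> \<Omega>)"
  define c where "c = \<eta> \<bullet> n / (n \<bullet> n)"
  have perp: "(\<eta> - c *\<^sub>R n) \<bullet> n = 0"
    using n by (simp add: c_def inner_diff_left)
  then have "\<eta> \<bullet> (\<eta> - c *\<^sub>R n) = 0"
    using \<eta> by blast
  then have "(\<eta> - c *\<^sub>R n) \<bullet> (\<eta> - c *\<^sub>R n) = 0"
    using perp by (simp add: inner_diff_left inner_commute)
  then have \<eta>_eq: "\<eta> = c *\<^sub>R n"
    by simp
  then have c: "\<bar>c\<bar> * norm n = 1"
    using \<eta> by simp
  have "\<not> c > 0"
  proof
    assume "c > 0"
    then have "\<eta> \<bullet> n > 0"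
      using n by (simp add: \<eta>_eq)
    then obtain e e' where "e > 0" "e' > 0"
        and "\<And>t. 0 < t \<Longrightarrow> t < e \<Longrightarrow> x + t *\<^sub>R \<eta> \<notin> \<Omega>"
        and "\<And>t. 0 < t \<Longrightarrow> t < e' \<Longrightarrow> x + t *\<^sub>R \<eta> \<in> \<Omega>"
      using gradient_pos_imp_outside[OF assms(1-4)] \<eta> by metis
    then show False
      using dense[of 0 "min e e'"] by auto
  qed
  then have "c = - inverse (norm n)"
    using c n by (simp add: abs_if field_simps split: if_splits)
  then show "\<eta> = - (n /\<^sub>R norm n)"
    by (simp add: \<eta>_eq)
qed

lemma inner_i_vec [simp]: "(\<i> *s x) \<bullet> (\<i> *s y) = x \<bullet> (y :: complex ^ 'n)"
  by (simp add: inner_vec_def inner_complex_def algebra_simps)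

lemma inner_i_vec_self [simp]: "(\<i> *s x) \<bullet> x = 0" "x \<bullet> (\<i> *s x) = 0" for x :: "complex ^ 'n"
  by (simp_all add: inner_vec_def inner_complex_def algebra_simps)

lemma norm_i_vec [simp]: "norm (\<i> *s x) = norm (x :: complex ^ 'n)"
  by (simp add: norm_eq_sqrt_inner)

text \<open>Complex linear in the first argument, so that composing it with a holomorphic disc there
  gives a holomorphic function.\<close>

definition hermitian :: "complex ^ 'n \<Rightarrow> complex ^ 'n \<Rightarrow> complex" where
  "hermitian v w = (\<Sum>k\<in>UNIV. cnj (w $ k) * v $ k)"

lemma Re_hermitian: "Re (hermitian v w) = v \<bullet> w"
  by (simp add: hermitian_def inner_vec_def inner_complex_def algebra_simps)

lemma Im_hermitian: "Im (hermitian v w) = v \<bullet> (\<i> *s w)"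
  by (simp add: hermitian_def inner_vec_def inner_complex_def algebra_simps)

lemma complex_tangent_space_eq:
  assumes "tangent_space \<Omega> \<xi> = {v. v \<bullet> \<eta> = 0}"
  shows "complex_tangent_space \<Omega> \<xi> = {v. hermitian v \<eta> = 0}"
proof -
  have "v \<in> (\<lambda>v. \<i> *s v) ` {v. v \<bullet> \<eta> = 0} \<longleftrightarrow> v \<bullet> (\<i> *s \<eta>) = 0" for v
  proof
    assume "v \<bullet> (\<i> *s \<eta>) = 0"
    moreover have v: "v = \<i> *s (- \<i> *s v)"
      by (simp add: vec_eq_iff)
    ultimately have "(- \<i> *s v) \<bullet> \<eta> = 0"
      by (metis inner_i_vec)
    then show "v \<in> (\<lambda>v. \<i> *s v) ` {v. v \<bullet> \<eta> = 0}"
      using v by blast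
  qed auto
  then show ?thesis
    unfolding complex_tangent_space_def assms by (auto simp: complex_eq_iff Re_hermitian Im_hermitian)
qed

text \<open>If \<open>y - \<xi>\<close> had positive product with \<open>n\<close>, the segment to
  \<open>y\<close> would start outside the domain, but convexity puts its points into the interior.
  Pushing \<open>x\<close> a little along \<open>n\<close> inside the open domain makes the
  inequality strict.\<close>

lemma convex_gradient_supporting:
  fixes \<Omega> :: "('a::euclidean_space) set"
  assumes "open \<Omega>" "convex \<Omega>" and \<rho>: "defining_function_on \<Omega> U \<rho>" and \<xi>: "\<xi> \<in> frontier \<Omega>" "\<xi> \<in> U"
    and der: "(\<rho> has_derivative (\<lambda>v. v \<bullet> n)) (at \<xi>)" and n: "n \<noteq> 0" and x: "x \<in> \<Omega>"
  shows "(x - \<xi>) \<bullet> n < 0"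
proof -
  have \<xi>c: "\<xi> \<in> closure \<Omega>"
    using \<xi> by (simp add: frontier_def)
  have le: "(y - \<xi>) \<bullet> n \<le> 0" if y: "y \<in> \<Omega>" for y
  proof (rule ccontr)
    assume "\<not> (y - \<xi>) \<bullet> n \<le> 0"
    then obtain e where e: "e > 0" "\<And>t. 0 < t \<Longrightarrow> t < e \<Longrightarrow> \<xi> + t *\<^sub>R (y - \<xi>) \<notin> \<Omega>"
      using gradient_pos_imp_outside[OF \<rho> \<xi> der, of "y - \<xi>"] by (auto simp: not_le)
    obtain t where t: "0 < t" "t < min e 1"
      using dense[of 0 "min e 1"] e by auto
    have "\<xi> - t *\<^sub>R (\<xi> - y) \<in> interior \<Omega>"
      using mem_interior_closure_convex_shrink[OF \<open>convex \<Omega>\<close>, of y \<xi> t] y \<xi>c t \<open>open \<Omega>\<close>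
      by (simp add: interior_open)
    then show False
      using e(2)[of t] t \<open>open \<Omega>\<close> by (simp add: interior_open algebra_simps)
  qed
  obtain e where e: "e > 0" "cball x e \<subseteq> \<Omega>"
    using \<open>open \<Omega>\<close> x open_contains_cball by blast
  have "x + (e / norm n) *\<^sub>R n \<in> cball x e"
    using e n by (simp add: dist_norm)
  then have "(x + (e / norm n) *\<^sub>R n - \<xi>) \<bullet> n \<le> 0"
    using e le by blast
  moreover have "(e / norm n) *\<^sub>R n \<bullet> n > 0"
    using e n by simp
  ultimately show ?thesis
    by (simp add: inner_diff_left inner_add_left)
qed

section \<open>The cusp region in each complex normal line\<close>

lemma dir_deriv_eq:
  assumes "(f has_derivative f') (at x)"
  shows "dir_deriv v f x = f' v"
  unfolding dir_deriv_def
  by (intro DERIV_imp_deriv has_real_derivative_along_line) (simp add: assms)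

text \<open>From \<open>\<xi>\<close>, first move by \<open>b\<close> along
  \<open>\<i> *s \<eta> \<xi>\<close>. The derivative of \<open>\<rho>\<close> in this direction
  vanishes at \<open>\<xi>\<close>, so \<open>\<rho>\<close> rises by at most
  \<open>\<bar>b\<bar> * \<omega> \<bar>b\<bar>\<close>. Then move by \<open>a\<close> along
  \<open>\<eta> \<xi>\<close>, which lowers \<open>\<rho>\<close> by at least
  \<open>c * a\<close>.\<close>

lemma boundary_cusp:
  fixes \<Omega> U :: "(complex ^ 'n) set"
  assumes "bounded \<Omega>" and r: "r > 0"
    and \<rho>: "defining_function \<Omega> U \<rho>"
    and U: "\<And>\<xi>. \<xi> \<in> frontier \<Omega> \<Longrightarrow> ball \<xi> r \<subseteq> U"
    and mod: "\<And>\<xi>. \<xi> \<in> frontier \<Omega> \<Longrightarrow>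
           has_modulus_of_continuity (dir_deriv (\<i> *s inward_unit_normal \<Omega> \<xi>) \<rho>) \<xi> r \<omega>"
  obtains c r0 where "0 < c" "0 < r0"
    "\<And>\<xi> a b. \<xi> \<in> frontier \<Omega> \<Longrightarrow> \<bar>b\<bar> < r0 \<Longrightarrow> 0 < a \<Longrightarrow> a < r0 \<Longrightarrow> \<bar>b\<bar> * \<omega> \<bar>b\<bar> < c * a \<Longrightarrow>
       \<xi> + a *\<^sub>R inward_unit_normal \<Omega> \<xi> + b *\<^sub>R (\<i> *s inward_unit_normal \<Omega> \<xi>) \<in> \<Omega>"
proof (cases "frontier \<Omega> = {}")
  case True
  then show ?thesis
    using that[of 1 1] by simp
next
  case False
  have \<rho>': "defining_function_on \<Omega> U \<rho>" and FU: "frontier \<Omega> \<subseteq> U"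
    using \<rho> by (auto simp: defining_function_def)
  obtain n where n: "continuous_on U n" "\<And>x. x \<in> U \<Longrightarrow> (\<rho> has_derivative (\<lambda>v. v \<bullet> n x)) (at x)"
    "\<And>x. x \<in> frontier \<Omega> \<inter> U \<Longrightarrow> n x \<noteq> 0"
    using defining_function_on_gradient[OF \<rho>'] by blast
  define \<eta> where "\<eta> \<xi> = inward_unit_normal \<Omega> \<xi>" for \<xi>
  have \<eta>: "\<eta> \<xi> = - (n \<xi> /\<^sub>R norm (n \<xi>))" if "\<xi> \<in> frontier \<Omega>" for \<xi>
    unfolding \<eta>_def using that FU n by (intro inward_unit_normal_eq[OF \<rho>']) auto
  have norm_\<eta>: "norm (\<eta> \<xi>) = 1" if "\<xi> \<in> frontier \<Omega>" for \<xi>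
    using that FU n(3) by (auto simp: \<eta>)
  have comp: "compact (frontier \<Omega>)"
    using \<open>bounded \<Omega>\<close> by (rule compact_frontier_bounded)
  have "continuous_on (frontier \<Omega>) (\<lambda>\<xi>. norm (n \<xi>))"
    by (rule continuous_on_norm[OF continuous_on_subset[OF n(1) FU]])
  then obtain \<xi>0 where \<xi>0: "\<xi>0 \<in> frontier \<Omega>" "\<And>\<xi>. \<xi> \<in> frontier \<Omega> \<Longrightarrow> norm (n \<xi>0) \<le> norm (n \<xi>)"
    using continuous_attains_inf[OF comp False] by blast
  \<comment> \<open>Half of the least gradient norm on the boundary. The other half absorbs the
    oscillation of \<open>n\<close> near \<open>\<xi>\<close>.\<close>
  define c where "c = norm (n \<xi>0) / 2"
  have c: "0 < c"
    using \<xi>0 FU n(3) by (auto simp: c_def)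
  \<comment> \<open>A compact neighbourhood of the boundary inside \<open>U\<close>, on which
    \<open>n\<close> is uniformly continuous. This makes \<open>r0\<close> independent of
    \<open>\<xi>\<close>.\<close>
  define K where "K = (\<Union>x\<in>frontier \<Omega>. \<Union>y\<in>cball 0 (r / 2). {x + y})"
  have "compact K"
    unfolding K_def by (intro compact_sums' comp) simp
  have KU: "K \<subseteq> U"
  proof
    fix z assume "z \<in> K"
    then obtain x y where "x \<in> frontier \<Omega>" "norm y \<le> r / 2" "z = x + y"
      by (auto simp: K_def)
    then show "z \<in> U"
      using U[of x] r by (auto simp: subset_iff dist_norm)
  qed
  then have "uniformly_continuous_on K n"
    by (rule compact_uniformly_continuous[OF continuous_on_subset[OF n(1)] \<open>compact K\<close>])
  then obtain d where d: "0 < d" "\<And>x y. x \<in> K \<Longrightarrow> y \<in> K \<Longrightarrow> dist y x < d \<Longrightarrow> dist (n y) (n x) < c"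
    using c unfolding uniformly_continuous_on_def by metis
  define r0 where "r0 = min d (r / 2) / 2"
  have r0: "0 < r0" "2 * r0 \<le> d" "2 * r0 \<le> r / 2"
    using d r by (auto simp: r0_def)
  show ?thesis
  proof (rule that[OF c r0(1)], unfold \<eta>_def[symmetric])
    fix \<xi> a b assume \<xi>: "\<xi> \<in> frontier \<Omega>" and b: "\<bar>b\<bar> < r0" and a: "0 < a" "a < r0"
      and ab: "\<bar>b\<bar> * \<omega> \<bar>b\<bar> < c * a"
    define p where "p s t = \<xi> + s *\<^sub>R \<eta> \<xi> + t *\<^sub>R (\<i> *s \<eta> \<xi>)" for s t
    have p_norm: "norm (p s t - \<xi>) \<le> \<bar>s\<bar> + \<bar>t\<bar>" for s t
      using norm_triangle_ineq[of "s *\<^sub>R \<eta> \<xi>" "t *\<^sub>R (\<i> *s \<eta> \<xi>)"] norm_\<eta>[OF \<xi>] by (simp add: p_def)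
    have p_in: "p s t \<in> K" "p s t \<in> U" "dist (p s t) \<xi> < d" "p s t \<in> ball \<xi> r"
      if "\<bar>s\<bar> < r0" "\<bar>t\<bar> < r0" for s t
    proof -
      have le: "norm (p s t - \<xi>) < 2 * r0"
        using p_norm[of s t] that by linarith
      then have "p s t - \<xi> \<in> cball 0 (r / 2)"
        using r0 by simp
      then show "p s t \<in> K"
        unfolding K_def using \<xi> by (force intro: bexI[of _ \<xi>] bexI[of _ "p s t - \<xi>"])
      then show "p s t \<in> U"
        using KU by blast
      show "dist (p s t) \<xi> < d"
        using le r0 by (simp add: dist_norm)
      show "p s t \<in> ball \<xi> r"
        using le r0 r by (simp add: dist_norm norm_minus_commute)
    qed
    have \<xi>K: "\<xi> \<in> K" "\<xi> \<in> U" "\<xi> \<in> ball \<xi> r"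
      using p_in[of 0 0] r0 by (auto simp: p_def)
    have n_\<xi>: "n \<xi> = - norm (n \<xi>) *\<^sub>R \<eta> \<xi>"
      using \<eta>[OF \<xi>] \<xi> \<xi>K n(3)[of \<xi>] by simp
    have perp: "(\<i> *s \<eta> \<xi>) \<bullet> n \<xi> = 0"
      by (subst n_\<xi>) simp
    have tangential: "\<rho> (p 0 b) \<le> \<bar>b\<bar> * \<omega> \<bar>b\<bar>"
    proof -
      let ?g = "\<lambda>t. \<rho> (\<xi> + t *\<^sub>R (\<i> *s \<eta> \<xi>))"
      have g: "(?g has_real_derivative (\<i> *s \<eta> \<xi>) \<bullet> n (p 0 t)) (at t)" if "\<bar>t\<bar> < r0" for t
        using n(2)[of "p 0 t"] p_in[of 0 t] that r0
        by (intro has_real_derivative_along_line) (auto simp: p_def)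
      have bound: "\<bar>(\<i> *s \<eta> \<xi>) \<bullet> n (p 0 t)\<bar> \<le> \<omega> \<bar>b\<bar>" if t: "\<bar>t\<bar> \<le> \<bar>b\<bar>" for t
      proof -
        have "\<bar>t\<bar> < r0"
          using t b by simp
        have "\<bar>dir_deriv (\<i> *s \<eta> \<xi>) \<rho> (p 0 t) - dir_deriv (\<i> *s \<eta> \<xi>) \<rho> \<xi>\<bar> \<le> \<omega> (norm (p 0 t - \<xi>))"
          using mod[OF \<xi>] p_in[of 0 t] \<open>\<bar>t\<bar> < r0\<close> r0 \<xi>K
          unfolding has_modulus_of_continuity_def \<eta>_def by auto
        moreover have "dir_deriv (\<i> *s \<eta> \<xi>) \<rho> (p 0 t) = (\<i> *s \<eta> \<xi>) \<bullet> n (p 0 t)"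
          using p_in[of 0 t] \<open>\<bar>t\<bar> < r0\<close> r0 by (intro dir_deriv_eq n) auto
        moreover have "dir_deriv (\<i> *s \<eta> \<xi>) \<rho> \<xi> = 0"
          using dir_deriv_eq[OF n(2)] \<xi>K perp by simp
        moreover have "norm (p 0 t - \<xi>) = \<bar>t\<bar>"
          using norm_\<eta>[OF \<xi>] by (simp add: p_def)
        moreover have "\<omega> \<bar>t\<bar> \<le> \<omega> \<bar>b\<bar>"
          using mod[OF \<xi>] t b r0 by (auto simp: has_modulus_of_continuity_def intro!: mono_onD[of "{0..<2*r}" \<omega>])
        ultimately show ?thesis
          by simp
      qed
      have "norm (?g b - ?g 0) \<le> \<omega> \<bar>b\<bar> * norm (b - 0)"
      proof (rule field_differentiable_bound[where S = "{- \<bar>b\<bar>..\<bar>b\<bar>}"])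
        show "(?g has_field_derivative (\<i> *s \<eta> \<xi>) \<bullet> n (p 0 t)) (at t within {- \<bar>b\<bar>..\<bar>b\<bar>})"
          if "t \<in> {- \<bar>b\<bar>..\<bar>b\<bar>}" for t
          using that b by (intro has_field_derivative_at_within[OF g]) auto
        show "norm ((\<i> *s \<eta> \<xi>) \<bullet> n (p 0 t)) \<le> \<omega> \<bar>b\<bar>" if "t \<in> {- \<bar>b\<bar>..\<bar>b\<bar>}" for t
          using that bound[of t] by auto
      qed auto
      moreover have "?g 0 = 0"
        using \<rho>' \<xi> \<xi>K by (auto simp: defining_function_on_def)
      ultimately show ?thesis
        by (simp add: p_def mult.commute)
    qed
    have normal: "\<rho> (p a b) \<le> \<rho> (p 0 b) - c * a"
    proof -
      let ?x = "\<xi> + b *\<^sub>R (\<i> *s \<eta> \<xi>)"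
      have p_eq: "p t b = ?x + t *\<^sub>R \<eta> \<xi>" for t
        by (simp add: p_def)
      have g: "((\<lambda>t. \<rho> (?x + t *\<^sub>R \<eta> \<xi>)) has_real_derivative \<eta> \<xi> \<bullet> n (p t b)) (at t)" if "0 \<le> t" "t \<le> a" for t
        using n(2)[of "p t b"] p_in[of t b] that b a
        by (intro has_real_derivative_along_line) (auto simp: p_eq)
      obtain t where t: "0 < t" "t < a"
        "\<rho> (?x + a *\<^sub>R \<eta> \<xi>) - \<rho> (?x + 0 *\<^sub>R \<eta> \<xi>) = (a - 0) * (\<eta> \<xi> \<bullet> n (p t b))"
        using MVT2[OF a(1) g] by blast
      have "norm (n (p t b) - n \<xi>) < c"
        using d(2)[of \<xi> "p t b"] \<xi>K p_in[of t b] t a b by (simp add: dist_norm)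
      then have "\<bar>\<eta> \<xi> \<bullet> (n (p t b) - n \<xi>)\<bar> \<le> c"
        using Cauchy_Schwarz_ineq2[of "\<eta> \<xi>" "n (p t b) - n \<xi>"] norm_\<eta>[OF \<xi>] by simp
      moreover have "\<eta> \<xi> \<bullet> n \<xi> = - norm (n \<xi>)"
        using norm_\<eta>[OF \<xi>] by (subst n_\<xi>) (simp add: dot_square_norm)
      moreover have "2 * c \<le> norm (n \<xi>)"
        using \<xi>0(2)[OF \<xi>] by (simp add: c_def)
      ultimately have "\<eta> \<xi> \<bullet> n (p t b) \<le> - c"
        by (simp add: inner_diff_right)
      then have "a * (\<eta> \<xi> \<bullet> n (p t b)) \<le> a * - c"
        using a by (intro mult_left_mono) auto
      then show ?thesis
        using t(3) by (simp add: p_eq algebra_simps)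
    qed
    have "\<rho> (p a b) < 0"
      using tangential normal ab by linarith
    then show "\<xi> + a *\<^sub>R \<eta> \<xi> + b *\<^sub>R (\<i> *s \<eta> \<xi>) \<in> \<Omega>"
      using p_in(2)[of a b] a b \<rho>' by (auto simp: p_def defining_function_on_def)
  qed
qed

subsection \<open>Estimates of the Kobayashi distance\<close>

lemma norm_vector_scalar_mult: "norm (c *s v) = cmod c * norm (v :: complex ^ 'n)"
  by (simp add: norm_vec_def norm_mult L2_set_right_distrib)

lemma of_real_vector_scalar_mult: "of_real t *s v = t *\<^sub>R (v :: complex ^ 'n)"
  unfolding vec_eq_iff vector_scaleR_component by (simp add: scaleR_conv_of_real[where 'a = complex])

text \<open>The Cayley transform takes the right half-plane to the disc and \<open>d\<close> to
  \<open>0\<close>. One computes \<open>1 - q\<^sup>2\<close> as \<open>4 * d * Re w\<close> over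
  the square of \<open>cmod (w + of_real d)\<close>, then uses \<open>Re w \<le> cmod w\<close> and
  \<open>cmod w \<le> cmod (w + of_real d)\<close>.\<close>

lemma cayley_transform_bounds:
  assumes d: "0 < d" and w: "0 < Re w"
  defines "q \<equiv> cmod ((w - of_real d) / (w + of_real d))"
  shows "q < 1" "1 - q\<^sup>2 \<le> 4 * d / cmod w"
proof -
  have ne: "0 < cmod w" "Re w \<le> cmod w"
    using w complex_Re_le_cmod[of w] by linarith+
  have sq: "(cmod (w - of_real d))\<^sup>2 = (cmod (w + of_real d))\<^sup>2 - 4 * d * Re w"
    unfolding cmod_power2 by (simp add: power2_eq_square algebra_simps)
  have ge: "(cmod w)\<^sup>2 \<le> (cmod (w + of_real d))\<^sup>2"
    unfolding cmod_power2 using d w by (simp add: power2_eq_square algebra_simps)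
  then have pos: "0 < (cmod (w + of_real d))\<^sup>2"
    using ne by (meson less_le_trans zero_less_power)
  have q2: "1 - q\<^sup>2 = 4 * d * Re w / (cmod (w + of_real d))\<^sup>2"
    using pos unfolding q_def norm_divide power_divide sq by (simp add: diff_divide_distrib)
  moreover have "0 < 4 * d * Re w / (cmod (w + of_real d))\<^sup>2"
    using d w pos by simp
  ultimately have "q\<^sup>2 < 1"
    by linarith
  then show "q < 1"
    by (simp add: q_def abs_square_less_1)
  have "4 * d * Re w / (cmod (w + of_real d))\<^sup>2 \<le> 4 * d * cmod w / (cmod w)\<^sup>2"
    using ge ne d pos w by (intro frac_le mult_left_mono) auto
  then show "1 - q\<^sup>2 \<le> 4 * d / cmod w"
    unfolding q2 using ne by (simp add: power2_eq_square)
qed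

lemma affine_disc_in_holomorphic_discs:
  assumes "\<And>z. cmod z < 1 \<Longrightarrow> p + (u + w * z) *s v \<in> \<Omega>"
  shows "(\<lambda>z. p + (u + w * z) *s v) \<in> holomorphic_discs \<Omega>"
  unfolding holomorphic_discs_def using assms by (auto intro!: holomorphic_intros)

text \<open>The distance estimates see the boundary only through its field of inward normals.
  \<open>C_strict\<close> is \<complex>-strict convexity with the complex tangent space written as
  the kernel of a Hermitian functional.\<close>

locale C_strict_normals =
  fixes \<Omega> :: "(complex ^ 'n) set" and \<eta> :: "complex ^ 'n \<Rightarrow> complex ^ 'n"
  assumes open_domain: "open \<Omega>" and bounded_domain: "bounded \<Omega>"
    and convex_domain: "convex \<Omega>" and nonempty_domain: "\<Omega> \<noteq> {}"
    and norm_normal: "\<xi> \<in> frontier \<Omega> \<Longrightarrow> norm (\<eta> \<xi>) = 1"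
    and continuous_on_normal: "continuous_on (frontier \<Omega>) \<eta>"
    and supporting: "\<xi> \<in> frontier \<Omega> \<Longrightarrow> x \<in> \<Omega> \<Longrightarrow> 0 < (x - \<xi>) \<bullet> \<eta> \<xi>"
    and C_strict: "\<xi> \<in> frontier \<Omega> \<Longrightarrow> x \<in> closure \<Omega> \<Longrightarrow> hermitian (x - \<xi>) (\<eta> \<xi>) = 0 \<Longrightarrow> x = \<xi>"
begin

section \<open>Boundary distance and nearest boundary points\<close>

lemma compact_boundary: "compact (frontier \<Omega>)"
  using bounded_domain by (rule compact_frontier_bounded)

lemma boundary_nonempty: "frontier \<Omega> \<noteq> {}"
  using nonempty_domain bounded_domain not_bounded_UNIV by (auto simp: frontier_eq_empty)

lemma infdist_boundary_pos:
  assumes "z \<in> \<Omega>"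
  shows "0 < infdist z (frontier \<Omega>)"
proof -
  have "z \<notin> frontier \<Omega>"
    using assms open_domain by (simp add: frontier_def interior_open)
  then show ?thesis
    using infdist_pos_not_in_closed[OF frontier_closed boundary_nonempty] by blast
qed

lemma ball_infdist_boundary_subset:
  assumes "z \<in> \<Omega>"
  shows "ball z (infdist z (frontier \<Omega>)) \<subseteq> \<Omega>"
proof (rule ccontr)
  assume "\<not> ?thesis"
  then have "ball z (infdist z (frontier \<Omega>)) - \<Omega> \<noteq> {}"
    by blast
  moreover have "z \<in> ball z (infdist z (frontier \<Omega>)) \<inter> \<Omega>"
    using assms infdist_boundary_pos by simp
  ultimately obtain w where "w \<in> ball z (infdist z (frontier \<Omega>))" "w \<in> frontier \<Omega>"
    using connected_Int_frontier[OF connected_ball] by blast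
  then show False
    using infdist_le[of w "frontier \<Omega>" z] by simp
qed

text \<open>The ball of radius \<open>d\<close> about \<open>z\<close> lies in the supporting
  half-space at a nearest point \<open>\<xi>\<close>, so
  \<open>(z - \<xi>) \<bullet> \<eta> \<xi>\<close> is at least \<open>d = norm (z - \<xi>)\<close>.
  Equality in Cauchy-Schwarz then forces \<open>z - \<xi>\<close> to be \<open>d\<close> times the
  normal.\<close>

lemma nearest_boundary_point:
  assumes z: "z \<in> \<Omega>"
  obtains \<xi> where "\<xi> \<in> frontier \<Omega>" "z = \<xi> + infdist z (frontier \<Omega>) *\<^sub>R \<eta> \<xi>"
proof -
  define d where "d = infdist z (frontier \<Omega>)"
  have d: "0 < d" and ball: "ball z d \<subseteq> \<Omega>"
    using infdist_boundary_pos[OF z] ball_infdist_boundary_subset[OF z] by (auto simp: d_def)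
  obtain \<xi> where \<xi>: "\<xi> \<in> frontier \<Omega>" "d = dist z \<xi>"
    using infdist_attains_inf[OF frontier_closed boundary_nonempty, of z] by (metis d_def)
  have nrm: "norm (\<eta> \<xi>) = 1"
    using norm_normal \<xi> by blast
  have ge: "t \<le> (z - \<xi>) \<bullet> \<eta> \<xi>" if t: "0 < t" "t < d" for t
  proof -
    have "z - t *\<^sub>R \<eta> \<xi> \<in> ball z d"
      using t nrm by (simp add: dist_norm)
    then have "0 < (z - t *\<^sub>R \<eta> \<xi> - \<xi>) \<bullet> \<eta> \<xi>"
      using ball supporting[OF \<xi>(1)] by blast
    then show ?thesis
      using nrm by (simp add: inner_diff_left dot_square_norm)
  qed
  have "d \<le> (z - \<xi>) \<bullet> \<eta> \<xi>"
    using d by (rule dense_le_bounded) (use ge in auto)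
  moreover have "(norm (z - \<xi> - d *\<^sub>R \<eta> \<xi>))\<^sup>2 = 2 * d * (d - (z - \<xi>) \<bullet> \<eta> \<xi>)"
    using dot_norm_neg[of "z - \<xi>" "d *\<^sub>R \<eta> \<xi>"] \<xi>(2) nrm d
    by (simp add: dist_norm[symmetric] power2_eq_square algebra_simps)
  ultimately have "(norm (z - \<xi> - d *\<^sub>R \<eta> \<xi>))\<^sup>2 \<le> 0"
    using d by (simp add: mult_nonneg_nonpos)
  then have "z = \<xi> + d *\<^sub>R \<eta> \<xi>"
    by (simp add: algebra_simps)
  then show ?thesis
    using that \<xi> by (simp add: d_def)
qed

text \<open>
  The functional \<open>x \<mapsto> hermitian (x - \<xi>) (\<eta> \<xi>)\<close> maps \<open>\<Omega>\<close> into the right half-plane and the point at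
  height \<open>d\<close> above \<open>\<xi>\<close> to \<open>d\<close>. By \<open>\<complex>\<close>-strict convexity and compactness it is bounded away from \<open>0\<close>
  at distance at least \<open>e\<close> from \<open>\<xi>\<close>. The chain in the hypothesis excludes the infimum of the empty set.
\<close>

lemma kobayashi_dist_lower:
  assumes e: "0 < e"
  obtains m where "0 < m"
    "\<And>\<xi> d x L. \<xi> \<in> frontier \<Omega> \<Longrightarrow> 0 < d \<Longrightarrow> x \<in> \<Omega> \<Longrightarrow> e \<le> norm (x - \<xi>) \<Longrightarrow>
       disc_chain (holomorphic_discs \<Omega>) (\<xi> + d *\<^sub>R \<eta> \<xi>) x L \<Longrightarrow>
       (ln m - ln d) / 2 \<le> kobayashi_dist \<Omega> (\<xi> + d *\<^sub>R \<eta> \<xi>) x"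
proof -
  define P where "P = (frontier \<Omega> \<times> closure \<Omega>) \<inter> {p. e \<le> norm (snd p - fst p)}"
  have "compact P"
    unfolding P_def using compact_boundary bounded_domain
    by (intro compact_Int_closed compact_Times closed_Collect_le continuous_intros) auto
  have cont: "continuous_on P (\<lambda>p. cmod (hermitian (snd p - fst p) (\<eta> (fst p))))"
  proof -
    have "continuous_on P (\<lambda>p. \<eta> (fst p))"
      by (rule continuous_on_compose2[OF continuous_on_normal]) (auto simp: P_def intro!: continuous_intros)
    then show ?thesis
      unfolding hermitian_def by (intro continuous_intros)
  qed
  have "\<exists>m>0. \<forall>p\<in>P. m \<le> cmod (hermitian (snd p - fst p) (\<eta> (fst p)))"
  proof (cases "P = {}")
    case True
    then show ?thesis
      by (intro exI[of _ 1]) auto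
  next
    case False
    obtain p where p: "p \<in> P"
      "\<And>p'. p' \<in> P \<Longrightarrow> cmod (hermitian (snd p - fst p) (\<eta> (fst p))) \<le> cmod (hermitian (snd p' - fst p') (\<eta> (fst p')))"
      using continuous_attains_inf[OF \<open>compact P\<close> False cont] by blast
    have "snd p \<noteq> fst p"
      using p(1) e by (auto simp: P_def)
    then have "0 < cmod (hermitian (snd p - fst p) (\<eta> (fst p)))"
      using C_strict[of "fst p" "snd p"] p(1) by (auto simp: P_def)
    then show ?thesis
      using p(2) by blast
  qed
  then obtain m where m: "m > 0" "\<And>p. p \<in> P \<Longrightarrow> m \<le> cmod (hermitian (snd p - fst p) (\<eta> (fst p)))"
    by blast
  show ?thesis
  \<comment> \<open>The division by four absorbs the constant of
    \<open>cayley_transform_bounds\<close>.\<close>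
  proof (rule that[of "m / 4"])
    fix \<xi> d x L
    assume \<xi>: "\<xi> \<in> frontier \<Omega>" and d: "0 < d" and x: "x \<in> \<Omega>" and e: "e \<le> norm (x - \<xi>)"
      and chain: "disc_chain (holomorphic_discs \<Omega>) (\<xi> + d *\<^sub>R \<eta> \<xi>) x L"
    define \<Phi> where "\<Phi> y = (hermitian (y - \<xi>) (\<eta> \<xi>) - of_real d) / (hermitian (y - \<xi>) (\<eta> \<xi>) + of_real d)" for y
    have Re: "0 < Re (hermitian (y - \<xi>) (\<eta> \<xi>))" if "y \<in> \<Omega>" for y
      using supporting[OF \<xi> that] by (simp add: Re_hermitian)
    have \<Phi>_lt: "cmod (\<Phi> y) < 1" if "y \<in> \<Omega>" for y
      using cayley_transform_bounds(1)[OF d Re[OF that]] by (simp add: \<Phi>_def)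
    have "artanh (cmod (\<Phi> x)) \<le> kobayashi_from_discs (holomorphic_discs \<Omega>) (\<xi> + d *\<^sub>R \<eta> \<xi>) x"
    proof (rule artanh_le_kobayashi_from_discs[OF _ _ chain])
      have "hermitian (d *\<^sub>R \<eta> \<xi>) (\<eta> \<xi>) = of_real d"
        using norm_normal[OF \<xi>] by (simp add: complex_eq_iff Re_hermitian Im_hermitian dot_square_norm)
      then show "\<Phi> (\<xi> + d *\<^sub>R \<eta> \<xi>) = 0"
        by (simp add: \<Phi>_def)
      fix f assume f: "f \<in> holomorphic_discs \<Omega>"
      then have fz: "f z \<in> \<Omega>" if "z \<in> ball 0 1" for z
        using that by (auto simp: holomorphic_discs_def)
      have "(\<lambda>z. \<Sum>k\<in>UNIV. cnj (\<eta> \<xi> $ k) * (f z $ k - \<xi> $ k)) holomorphic_on ball 0 1"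
        using f unfolding holomorphic_discs_def by (intro holomorphic_intros) auto
      then have h: "(\<lambda>z. hermitian (f z - \<xi>) (\<eta> \<xi>)) holomorphic_on ball 0 1"
        by (simp add: hermitian_def)
      have "hermitian (f z - \<xi>) (\<eta> \<xi>) + of_real d \<noteq> 0" if "z \<in> ball 0 1" for z
        using Re[OF fz[OF that]] d by (auto simp: complex_eq_iff)
      then have "\<Phi> \<circ> f holomorphic_on ball 0 1"
        unfolding \<Phi>_def comp_def using h by (intro holomorphic_intros) auto
      then show "\<Phi> \<circ> f holomorphic_on ball 0 1 \<and> (\<Phi> \<circ> f) ` ball 0 1 \<subseteq> ball 0 1"
        using fz \<Phi>_lt by auto
    qed
    moreover have "- ln (4 * d / m) / 2 \<le> artanh (cmod (\<Phi> x))"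
    proof (rule half_neg_ln_le_artanh)
      have "(\<xi>, x) \<in> P"
        using \<xi> x e closure_subset by (auto simp: P_def)
      then have "m \<le> cmod (hermitian (x - \<xi>) (\<eta> \<xi>))"
        using m(2) by fastforce
      then have "4 * d / cmod (hermitian (x - \<xi>) (\<eta> \<xi>)) \<le> 4 * d / m"
        using m d by (intro frac_le) auto
      then show "1 - (cmod (\<Phi> x))\<^sup>2 \<le> 4 * d / m"
        using cayley_transform_bounds(2)[OF d Re[OF x]] by (simp add: \<Phi>_def)
    qed (use \<Phi>_lt[OF x] m d in auto)
    moreover have "ln (4 * d / m) = - (ln (m / 4) - ln d)"
      using m d by (simp add: ln_div ln_mult)
    ultimately show "(ln (m / 4) - ln d) / 2 \<le> kobayashi_dist \<Omega> (\<xi> + d *\<^sub>R \<eta> \<xi>) x"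
      by (simp add: kobayashi_dist_def)
  qed (use m in simp)
qed

text \<open>By convexity every point of the segment from \<open>x\<close> to \<open>y\<close> has
  its \<open>s\<close>-ball in the domain. The segment is cut into \<open>N\<close> pieces, each
  covered by an affine disc of parameter radius \<open>2 / N\<close> from parameter \<open>0\<close>
  to \<open>1 / 2\<close>. Boundedness of the domain makes \<open>N\<close> uniform.\<close>

lemma disc_chain_interior:
  assumes s: "0 < s"
  obtains M where "\<And>x y. ball x s \<subseteq> \<Omega> \<Longrightarrow> ball y s \<subseteq> \<Omega> \<Longrightarrow> \<exists>L\<le>M. disc_chain (holomorphic_discs \<Omega>) x y L"
proof -
  obtain D where D: "\<And>x. x \<in> \<Omega> \<Longrightarrow> norm x \<le> D"
    using bounded_domain by (auto simp: bounded_iff)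
  obtain N0 :: nat where N0: "4 * D / s < of_nat N0"
    using reals_Archimedean2 by blast
  define N where "N = Suc N0"
  have N: "0 < N" "4 * D < s * real N"
    using N0 s by (auto simp: N_def field_simps intro: less_le_trans)
  show ?thesis
  proof
    fix x y assume xs: "ball x s \<subseteq> \<Omega>" and ys: "ball y s \<subseteq> \<Omega>"
    define p where "p t = x + t *\<^sub>R (y - x)" for t
    have xy: "x \<in> \<Omega>" "y \<in> \<Omega>"
      using s xs ys by (auto simp: subset_iff)
    then have nxy: "norm (y - x) \<le> 2 * D"
      using D norm_triangle_ineq4[of y x] by (smt (verit))
    have p_in: "p t + v \<in> \<Omega>" if "0 \<le> t" "t \<le> 1" "norm v < s" for t v
    proof -
      have "x + v \<in> \<Omega>" "y + v \<in> \<Omega>"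
        using xs ys that by (auto simp: subset_iff dist_norm)
      then have "(1 - t) *\<^sub>R (x + v) + t *\<^sub>R (y + v) \<in> \<Omega>"
        using that by (intro convexD[OF convex_domain]) auto
      then show ?thesis
        by (simp add: p_def algebra_simps)
    qed
    have "disc_chain (holomorphic_discs \<Omega>) x (p (j / N)) (j * artanh (1 / 2))" if "j \<le> N" for j
      using that
    proof (induction j)
      case 0
      then show ?case
        by (simp add: p_def disc_chain_refl)
    next
      case (Suc j)
      have disc: "(\<lambda>z. p (j / N) + (0 + of_real (2 / N) * z) *s (y - x)) \<in> holomorphic_discs \<Omega>"
      proof (intro affine_disc_in_holomorphic_discs p_in)
        fix z :: complex assume z: "cmod z < 1"
        have "2 / N * cmod z * norm (y - x) \<le> 2 / N * 1 * (2 * D)"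
          using z nxy by (intro mult_mono) auto
        also have "\<dots> < s"
          using N by (simp add: field_simps)
        finally show "norm ((0 + of_real (2 / N) * z) *s (y - x)) < s"
          using N by (simp only: add_0 norm_vector_scalar_mult norm_mult norm_of_real) simp
      qed (use Suc N in auto)
      have "disc_chain (holomorphic_discs \<Omega>) x (p (Suc j / N)) (j * artanh (1 / 2) + poincare_dist 0 (1 / 2))"
      proof (rule disc_chain_snoc[OF _ disc])
        have half: "0 + of_real (2 / N) * (1 / 2) = complex_of_real (1 / N)"
          by simp
        show "p (j / N) + (0 + of_real (2 / N) * (1 / 2)) *s (y - x) = p (Suc j / N)"
          unfolding half of_real_vector_scalar_mult
          by (simp add: p_def add_divide_distrib scaleR_add_left add.commute)
        show "1 / 2 \<in> ball (0::complex) 1"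
          by (simp add: norm_divide)
      qed (use Suc in auto)
      then show ?case
        by (simp add: poincare_dist_def norm_divide algebra_simps)
    qed
    from this[of N] have "disc_chain (holomorphic_discs \<Omega>) x y (N * artanh (1 / 2))"
      using N by (simp add: p_def)
    then show "\<exists>L\<le>N * artanh (1 / 2). disc_chain (holomorphic_discs \<Omega>) x y L"
      by blast
  qed
qed

text \<open>A chain of uniformly bounded length leads from \<open>x\<close> to height
  \<open>d0\<close> above \<open>\<xi>\<close>, and the descent through the cusp covers the rest.
  All constants are independent of \<open>\<xi>\<close>.\<close>

lemma disc_chain_to_boundary:
  fixes \<omega> :: "real \<Rightarrow> real"
  assumes dini: "dini_condition (2 * r) \<omega>" and mono: "mono_on {0..<2 * r} \<omega>"
    and cont: "continuous (at 0 within {0..<2 * r}) \<omega>" and \<omega>0: "\<omega> 0 = 0"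
    and c: "0 < c" and r0: "0 < r0"
    and cusp: "\<And>\<xi> a b. \<xi> \<in> frontier \<Omega> \<Longrightarrow> \<bar>b\<bar> < r0 \<Longrightarrow> 0 < a \<Longrightarrow> a < r0 \<Longrightarrow> \<bar>b\<bar> * \<omega> \<bar>b\<bar> < c * a \<Longrightarrow>
       \<xi> + a *\<^sub>R \<eta> \<xi> + b *\<^sub>R (\<i> *s \<eta> \<xi>) \<in> \<Omega>"
    and x: "x \<in> \<Omega>"
  obtains C d0 where "0 < d0"
    "\<And>\<xi> d. \<xi> \<in> frontier \<Omega> \<Longrightarrow> 0 < d \<Longrightarrow> d \<le> d0 \<Longrightarrow>
       \<exists>L \<le> C - ln d / 2. disc_chain (holomorphic_discs \<Omega>) x (\<xi> + d *\<^sub>R \<eta> \<xi>) L"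
proof -
  obtain R s S where R: "0 < R" "R < r0 / 4" "R < 2 * r"
    and s: "\<And>j. 0 < s j" "\<And>j. s j \<le> 1 / 4"
    and s_Suc: "\<And>j. s j / 2 \<le> s (Suc j)" "\<And>j. s (Suc j) \<le> s j"
    and dom: "\<And>j::nat. \<omega> (R / 2 ^ j) \<le> c * s j" and S: "\<And>j. (\<Sum>i<j. s i) \<le> S"
    \<comment> \<open>The bound \<open>r0 / 4\<close> meets the requirement
      \<open>4 * R \<le> r0\<close> of \<open>cusp_contains_disc\<close>.\<close>
    using Dini_scales[OF dini mono cont \<omega>0 c, of "r0 / 4"] r0 by auto
  define d0 where "d0 = R * s 0"
  have "R * s 0 \<le> R * 1"
    using R s(2)[of 0] by (intro mult_left_mono) auto
  then have d0: "0 < d0" "d0 < r0"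
    using R s(1)[of 0] mult_pos_pos[of R "s 0"] unfolding d0_def by linarith+
  \<comment> \<open>The boundary pushed inwards by \<open>d0\<close> is a compact subset of the
    domain, so its points share one radius \<open>t\<close> of inner balls.\<close>
  define Y where "Y = (\<lambda>\<xi>. \<xi> + d0 *\<^sub>R \<eta> \<xi>) ` frontier \<Omega>"
  have "compact Y"
    unfolding Y_def using continuous_on_normal
    by (intro compact_continuous_image compact_boundary continuous_intros)
  moreover have "Y \<subseteq> \<Omega>"
    unfolding Y_def using cusp[of _ 0 d0] d0 c by auto
  ultimately obtain t where t: "0 < t" "(\<Union>y\<in>insert x Y. ball y t) \<subseteq> \<Omega>"
    using compact_subset_open_imp_ball_epsilon_subset[of "insert x Y" \<Omega>] open_domain x by auto
  obtain M where M: "\<And>x y. ball x t \<subseteq> \<Omega> \<Longrightarrow> ball y t \<subseteq> \<Omega> \<Longrightarrow> \<exists>L\<le>M. disc_chain (holomorphic_discs \<Omega>) x y L"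
    using disc_chain_interior[OF t(1)] by blast
  show ?thesis
  proof (rule that[OF d0(1), of "M + ln d0 / 2 + 5 / 2 * S"])
    fix \<xi> d assume \<xi>: "\<xi> \<in> frontier \<Omega>" and d: "0 < d" "d \<le> d0"
    define l where "l z = \<xi> + z *s \<eta> \<xi>" for z
    have l_real: "l (of_real a) = \<xi> + a *\<^sub>R \<eta> \<xi>" for a
      by (simp add: l_def of_real_vector_scalar_mult)
    have l_Complex: "l z = \<xi> + Re z *\<^sub>R \<eta> \<xi> + Im z *\<^sub>R (\<i> *s \<eta> \<xi>)" for z
      by (simp add: l_def vec_eq_iff complex_eq_iff)
    have "\<xi> + d0 *\<^sub>R \<eta> \<xi> \<in> Y"
      using \<xi> by (simp add: Y_def)
    then obtain L where L: "L \<le> M" "disc_chain (holomorphic_discs \<Omega>) x (l (of_real d0)) L"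
      using M[of x "\<xi> + d0 *\<^sub>R \<eta> \<xi>"] t(2) by (auto simp: l_real)
    have disc: "(\<lambda>z. l (of_real (R / 2 ^ j * (s j)\<^sup>2 / 2 + R / 2 ^ j) + of_real (R / 2 ^ j) * z)) \<in> holomorphic_discs \<Omega>" for j
      unfolding l_def
    proof (rule affine_disc_in_holomorphic_discs)
      fix z :: complex assume "cmod z < 1"
      then have z: "(Re z)\<^sup>2 + (Im z)\<^sup>2 < 1"
        by (simp add: cmod_power2[symmetric] abs_square_less_1)
      have Rj: "0 < R / 2 ^ j" "R / 2 ^ j \<le> R"
        using R by (auto simp: field_simps)
      have "l (of_real (R / 2 ^ j * (s j)\<^sup>2 / 2 + R / 2 ^ j) + of_real (R / 2 ^ j) * z) \<in> \<Omega>"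
        using cusp_contains_disc[OF mono c Rj(1) _ _ s(1)[of j] s(2)[of j] dom[of j] z, of r0] R Rj
        unfolding l_Complex by (intro cusp \<xi>) auto
      then show "\<xi> + (of_real (R / 2 ^ j * (s j)\<^sup>2 / 2 + R / 2 ^ j) + of_real (R / 2 ^ j) * z) *s \<eta> \<xi> \<in> \<Omega>"
        by (simp add: l_def)
    qed
    have "\<exists>M. disc_chain (holomorphic_discs \<Omega>) x (l (of_real d)) M \<and> M \<le> L + (ln (R * s 0) - ln d) / 2 + 5 / 2 * S"
      using L(2) R(1) d unfolding d0_def
      by (intro disc_chain_descend disc s s_Suc S)
    then obtain L' where L': "disc_chain (holomorphic_discs \<Omega>) x (l (of_real d)) L'"
      "L' \<le> L + (ln d0 - ln d) / 2 + 5 / 2 * S"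
      unfolding d0_def by blast
    have "L' \<le> M + ln d0 / 2 + 5 / 2 * S - ln d / 2"
      using L'(2) L(1) by argo
    then show "\<exists>L\<le>M + ln d0 / 2 + 5 / 2 * S - ln d / 2. disc_chain (holomorphic_discs \<Omega>) x (\<xi> + d *\<^sub>R \<eta> \<xi>) L"
      using L'(1) by (auto simp: l_real)
  qed
qed

text \<open>Both distance estimates contain \<open>- ln (\<delta> z) / 2\<close>. Subtracting them
  cancels this term and leaves a bound on \<open>artanh (t * cmod z)\<close> that depends only on
  the oscillation \<open>e\<close>.\<close>

lemma geodesic_boundary_extension:
  assumes geodesic: "complex_geodesic \<Omega> F" and d0: "0 < d0"
    and upper: "\<And>\<xi> d. \<xi> \<in> frontier \<Omega> \<Longrightarrow> 0 < d \<Longrightarrow> d \<le> d0 \<Longrightarrow>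
       \<exists>L \<le> C - ln d / 2. disc_chain (holomorphic_discs \<Omega>) (F 0) (\<xi> + d *\<^sub>R \<eta> \<xi>) L"
  shows "\<exists>G. continuous_on (cball 0 1) G \<and> (\<forall>z\<in>ball 0 1. G z = F z)"
proof -
  have F: "F \<in> holomorphic_discs \<Omega>"
    and isom: "\<And>z w. z \<in> ball 0 1 \<Longrightarrow> w \<in> ball 0 1 \<Longrightarrow>
      kobayashi_dist \<Omega> (F z) (F w) = kobayashi_dist_disc z w"
    using geodesic by (auto simp: complex_geodesic_def)
  have F_in: "F z \<in> \<Omega>" if "z \<in> ball 0 1" for z
    using F that by (auto simp: holomorphic_discs_def)
  have "continuous_on (ball 0 1) (\<lambda>z. \<chi> k. F z $ k)"
    using F by (intro continuous_on_vec_lambda holomorphic_on_imp_continuous_on) (auto simp: holomorphic_discs_def)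
  then have F_cont: "continuous_on (ball 0 1) F"
    by simp
  define \<delta> where "\<delta> z = infdist (F z) (frontier \<Omega>)" for z
  have \<delta>_pos: "0 < \<delta> z" if "z \<in> ball 0 1" for z
    using infdist_boundary_pos[OF F_in[OF that]] by (simp add: \<delta>_def)
  have from_0: "artanh (cmod z) \<le> L"
    if "z \<in> ball 0 1" "disc_chain (holomorphic_discs \<Omega>) (F 0) (F z) L" for z L
    using artanh_cmod_le_kobayashi_dist_disc[OF that(1)] isom[of 0 z] that(1)
      kobayashi_from_discs_le[OF that(2)] by (simp add: kobayashi_dist_def)
  have le_artanh: "K \<le> artanh t" if "tanh K \<le> t" "t < 1" for K t :: real
    using tanh_real_gt_neg1[of K] artanh_real_mono[of "tanh K" t] that by (simp add: artanh_tanh_real)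
  \<comment> \<open>Points at distance at least \<open>d\<close> from the boundary are joined to
    \<open>F 0\<close> by chains of bounded length, so their preimages stay in a compact part of the
    disc.\<close>
  have proper: "\<exists>R<1. \<forall>z. R \<le> cmod z \<and> cmod z < 1 \<longrightarrow> \<delta> z < d" if d: "0 < d" for d
  proof -
    define s where "s = min d (\<delta> 0)"
    have "0 < s"
      using d \<delta>_pos[of 0] by (simp add: s_def)
    then obtain M where M: "\<And>x y. ball x s \<subseteq> \<Omega> \<Longrightarrow> ball y s \<subseteq> \<Omega> \<Longrightarrow>
        \<exists>L\<le>M. disc_chain (holomorphic_discs \<Omega>) x y L"
      using disc_chain_interior by blast
    have "\<delta> z < d" if z: "tanh (M + 1) \<le> cmod z" "cmod z < 1" for z
    proof (rule ccontr)
      assume "\<not> \<delta> z < d"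
      then have "ball (F z) s \<subseteq> \<Omega>" "ball (F 0) s \<subseteq> \<Omega>"
        using ball_infdist_boundary_subset[OF F_in[of z]] ball_infdist_boundary_subset[OF F_in[of 0]] z
        by (auto simp: s_def \<delta>_def subset_iff)
      then obtain L where "L \<le> M" "disc_chain (holomorphic_discs \<Omega>) (F 0) (F z) L"
        using M by blast
      then have "artanh (cmod z) \<le> M"
        using from_0[of z L] z by simp
      then show False
        using le_artanh[OF z] by simp
    qed
    then show ?thesis
      using tanh_real_lt_1 by blast
  qed
  have radial: "\<exists>R<1. \<forall>z t. cmod z < 1 \<and> 0 \<le> t \<and> t \<le> 1 \<and> R \<le> t * cmod z \<longrightarrow> dist (F (of_real t * z)) (F z) < e"
    if e: "0 < e" for e
  proof -
    obtain m where m: "0 < m"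
      "\<And>\<xi> d x L. \<xi> \<in> frontier \<Omega> \<Longrightarrow> 0 < d \<Longrightarrow> x \<in> \<Omega> \<Longrightarrow> e / 2 \<le> norm (x - \<xi>) \<Longrightarrow>
         disc_chain (holomorphic_discs \<Omega>) (\<xi> + d *\<^sub>R \<eta> \<xi>) x L \<Longrightarrow>
         (ln m - ln d) / 2 \<le> kobayashi_dist \<Omega> (\<xi> + d *\<^sub>R \<eta> \<xi>) x"
      using kobayashi_dist_lower[of "e / 2"] e by (metis half_gt_zero)
    obtain R1 where R1: "R1 < 1" "\<And>z. R1 \<le> cmod z \<Longrightarrow> cmod z < 1 \<Longrightarrow> \<delta> z < min d0 (e / 2)"
      using proper[of "min d0 (e / 2)"] d0 e by auto
    \<comment> \<open>The two estimates will give \<open>artanh (t * cmod z) \<le> K - 1\<close>;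
      the added \<open>1\<close> turns this into a contradiction.\<close>
    define K where "K = C - ln m / 2 + 1"
    have "dist (F (of_real t * z)) (F z) < e"
      if z: "cmod z < 1" and t: "0 \<le> t" "t \<le> 1" and ge: "max R1 (tanh K) \<le> t * cmod z" for z t
    proof (rule ccontr)
      assume far: "\<not> dist (F (of_real t * z)) (F z) < e"
      have tz: "t * cmod z \<le> cmod z"
        using t by (simp add: mult_left_le_one_le)
      have z_in: "z \<in> ball 0 1" "of_real t * z \<in> ball 0 1"
        using z t tz by (auto simp: norm_mult)
      have \<delta>z: "\<delta> z < d0" "\<delta> z < e / 2" "0 < \<delta> z"
        using R1(2)[of z] z tz ge \<delta>_pos[OF z_in(1)] by auto
      obtain \<xi> where \<xi>: "\<xi> \<in> frontier \<Omega>" "F z = \<xi> + \<delta> z *\<^sub>R \<eta> \<xi>"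
        using nearest_boundary_point[OF F_in[OF z_in(1)]] by (metis \<delta>_def)
      have "norm (F z - \<xi>) = \<delta> z"
        using norm_normal[OF \<xi>(1)] \<delta>z by (simp add: \<xi>(2))
      then have "e / 2 \<le> norm (F (of_real t * z) - \<xi>)"
        using far \<delta>z norm_triangle_ineq4[of "F (of_real t * z) - \<xi>" "F z - \<xi>"] by (simp add: dist_norm)
      \<comment> \<open>The geodesic itself is a one-link chain, as the lower estimate
        demands.\<close>
      moreover have "disc_chain (holomorphic_discs \<Omega>) (F z) (F (of_real t * z)) (poincare_dist z (of_real t * z))"
        using F z_in by (intro disc_chain_single[of F]) auto
      ultimately have "(ln m - ln (\<delta> z)) / 2 \<le> kobayashi_dist \<Omega> (F z) (F (of_real t * z))"
        using m(2)[OF \<xi>(1) \<delta>z(3) F_in[OF z_in(2)]] \<xi>(2) by metis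
      also have "\<dots> \<le> poincare_dist z (of_real t * z)"
        using isom[OF z_in] kobayashi_dist_disc_le[OF z_in] by simp
      also have "\<dots> = artanh (cmod z) - artanh (t * cmod z)"
        using z_in t by (intro poincare_dist_collinear) auto
      finally have "(ln m - ln (\<delta> z)) / 2 \<le> artanh (cmod z) - artanh (t * cmod z)" .
      moreover have "artanh (cmod z) \<le> C - ln (\<delta> z) / 2"
        using upper[OF \<xi>(1) \<delta>z(3)] \<delta>z(1) from_0[OF z_in(1)] \<xi>(2) by fastforce
      moreover have "K \<le> artanh (t * cmod z)"
        using ge tz z by (intro le_artanh) auto
      ultimately show False
        unfolding K_def by argo
    qed
    moreover have "max R1 (tanh K) < 1"
      using R1 tanh_real_lt_1 by simp
    ultimately show ?thesis
      by blast
  qed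
  \<comment> \<open>With \<open>g\<close> the radial retraction onto the closed disc of radius
    \<open>R\<close>, \<open>F \<circ> g\<close> is uniformly continuous by compactness and differs
    from \<open>F\<close> by less than \<open>e / 3\<close>.\<close>
  have "uniformly_continuous_on (ball 0 1) F"
    unfolding uniformly_continuous_on_def
  proof (intro allI impI)
    fix e :: real assume e: "0 < e"
    then obtain R0 where R0: "R0 < 1" "\<And>z t. cmod z < 1 \<Longrightarrow> 0 \<le> t \<Longrightarrow> t \<le> 1 \<Longrightarrow> R0 \<le> t * cmod z \<Longrightarrow>
        dist (F (of_real t * z)) (F z) < e / 3"
      using radial[of "e / 3"] by auto
    obtain R where R: "0 < R" "R0 < R" "R < 1"
      using dense[of "max 0 R0" 1] R0 by auto
    \<comment> \<open>The maximum makes \<open>t\<close> continuous: it is \<open>1\<close> for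
      \<open>cmod z \<le> R\<close> and \<open>R / cmod z\<close> beyond, where
      \<open>t z * cmod z = R > R0\<close>.\<close>
    define t where "t z = R / max R (cmod z)" for z
    have t: "0 \<le> t z" "t z \<le> 1" "t z * cmod z \<le> R" for z
      using R by (auto simp: t_def divide_le_eq less_max_iff_disj le_max_iff_disj mult_left_mono)
    define g where "g z = of_real (t z) * z" for z
    have g_cont: "continuous_on (cball 0 1) g"
      unfolding g_def t_def using R by (intro continuous_intros) auto
    have g_in: "g z \<in> ball 0 1" for z
      using t[of z] R by (simp add: g_def norm_mult)
    have near: "dist (F (g z)) (F z) < e / 3" if z: "z \<in> ball 0 1" for z
    proof (cases "cmod z \<le> R")
      case True
      then show ?thesis
        using R e by (simp add: g_def t_def)
    next
      case False
      then show ?thesis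
        unfolding g_def using z R t[of z] by (intro R0) (auto simp: t_def)
    qed
    have "uniformly_continuous_on (cball 0 1) (F \<circ> g)"
      using g_in by (intro compact_uniformly_continuous continuous_on_compose g_cont
          continuous_on_subset[OF F_cont]) auto
    then obtain d where d: "0 < d" "\<And>z w. z \<in> cball 0 1 \<Longrightarrow> w \<in> cball 0 1 \<Longrightarrow> dist w z < d \<Longrightarrow>
        dist (F (g w)) (F (g z)) < e / 3"
      using e unfolding uniformly_continuous_on_def by (metis comp_apply zero_less_divide_iff zero_less_numeral)
    have "dist (F w) (F z) < e" if "z \<in> ball 0 1" "w \<in> ball 0 1" "dist w z < d" for z w
      using near[OF that(1)] near[OF that(2)] d(2)[of z w] that dist_triangle_third[of "F w" "F (g w)" e "F (g z)" "F z"]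
      by (simp add: dist_commute)
    then show "\<exists>d>0. \<forall>z\<in>ball 0 1. \<forall>w\<in>ball 0 1. dist w z < d \<longrightarrow> dist (F w) (F z) < e"
      using d(1) by blast
  qed
  then obtain G where "uniformly_continuous_on (closure (ball 0 1)) G" "\<And>z. z \<in> ball 0 1 \<Longrightarrow> F z = G z"
    using uniformly_continuous_on_extension_on_closure by metis
  then show ?thesis
    by (intro exI[of _ G]) (auto dest: uniformly_continuous_imp_continuous)
qed

end

section \<open>Continuous extension of complex geodesics\<close>

theorem corollary1p4:
  fixes \<Omega> U :: "(complex ^ 'n) set"
    and r :: real
    and \<omega> :: "real \<Rightarrow> real"
    and \<rho> :: "complex ^ 'n \<Rightarrow> real"
    and F :: "complex \<Rightarrow> complex ^ 'n"
  assumes "open \<Omega>" "connected \<Omega>" "\<Omega> \<noteq> {}" "bounded \<Omega>" "convex \<Omega>"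
    and "C1_boundary \<Omega>"
    and "C_strictly_convex \<Omega>"
    and "r > 0"
    and "dini_condition (2 * r) \<omega>"
    and "defining_function \<Omega> U \<rho>"
    and "\<And>\<xi>. \<xi> \<in> frontier \<Omega> \<Longrightarrow> ball \<xi> r \<subseteq> U"
    and "\<And>\<xi>. \<xi> \<in> frontier \<Omega> \<Longrightarrow>
           has_modulus_of_continuity (dir_deriv (\<i> *s inward_unit_normal \<Omega> \<xi>) \<rho>) \<xi> r \<omega>"
    and "complex_geodesic \<Omega> F"
  shows "\<exists>G. continuous_on (cball 0 1) G \<and> (\<forall>z\<in>ball 0 1. G z = F z)"
proof -
  let ?\<eta> = "inward_unit_normal \<Omega>"
  have def_on: "defining_function_on \<Omega> U \<rho>" and FU: "frontier \<Omega> \<subseteq> U"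
    using assms(10) by (auto simp: defining_function_def)
  obtain n where n: "continuous_on U n" "\<And>x. x \<in> U \<Longrightarrow> (\<rho> has_derivative (\<lambda>v. v \<bullet> n x)) (at x)"
    "\<And>x. x \<in> frontier \<Omega> \<inter> U \<Longrightarrow> n x \<noteq> 0"
    using defining_function_on_gradient[OF def_on] by blast
  have U: "\<xi> \<in> U" and der: "(\<rho> has_derivative (\<lambda>v. v \<bullet> n \<xi>)) (at \<xi>)" and ne: "n \<xi> \<noteq> 0"
    if "\<xi> \<in> frontier \<Omega>" for \<xi>
    using that FU n(2,3) by auto
  have \<eta>: "?\<eta> \<xi> = - (n \<xi> /\<^sub>R norm (n \<xi>))" if "\<xi> \<in> frontier \<Omega>" for \<xi>
    by (rule inward_unit_normal_eq[OF def_on that U[OF that] der[OF that] ne[OF that]])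
  interpret C_strict_normals \<Omega> ?\<eta>
  proof
    show "norm (?\<eta> \<xi>) = 1" if "\<xi> \<in> frontier \<Omega>" for \<xi>
      using ne[OF that] by (simp add: \<eta>[OF that])
    have "continuous_on (frontier \<Omega>) (\<lambda>\<xi>. - (n \<xi> /\<^sub>R norm (n \<xi>)))"
      using ne by (intro continuous_intros continuous_on_subset[OF n(1) FU]) auto
    then show "continuous_on (frontier \<Omega>) ?\<eta>"
      using \<eta> by (simp cong: continuous_on_cong)
    show "0 < (x - \<xi>) \<bullet> ?\<eta> \<xi>" if \<xi>: "\<xi> \<in> frontier \<Omega>" and x: "x \<in> \<Omega>" for \<xi> x
      using convex_gradient_supporting[OF assms(1,5) def_on \<xi> U[OF \<xi>] der[OF \<xi>] ne[OF \<xi>] x] ne[OF \<xi>]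
      by (simp add: \<eta>[OF \<xi>] mult_pos_neg)
    show "x = \<xi>" if \<xi>: "\<xi> \<in> frontier \<Omega>" and x: "x \<in> closure \<Omega>" and h: "hermitian (x - \<xi>) (?\<eta> \<xi>) = 0" for \<xi> x
    proof -
      have "tangent_space \<Omega> \<xi> = {v. v \<bullet> ?\<eta> \<xi> = 0}"
        using ne[OF \<xi>] by (simp add: tangent_space_eq[OF def_on \<xi> U[OF \<xi>] der[OF \<xi>]] \<eta>[OF \<xi>])
      then have "x - \<xi> \<in> complex_tangent_space \<Omega> \<xi>"
        using h by (simp add: complex_tangent_space_eq)
      then have "x \<in> (\<lambda>v. \<xi> + v) ` complex_tangent_space \<Omega> \<xi>"
        by (intro image_eqI[of _ _ "x - \<xi>"]) auto
      then show ?thesis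
        using assms(7) \<xi> x unfolding C_strictly_convex_def by blast
    qed
  qed (fact assms)+
  obtain c r0 where c: "0 < c" "0 < r0"
    and cusp: "\<And>\<xi> a b. \<xi> \<in> frontier \<Omega> \<Longrightarrow> \<bar>b\<bar> < r0 \<Longrightarrow> 0 < a \<Longrightarrow> a < r0 \<Longrightarrow> \<bar>b\<bar> * \<omega> \<bar>b\<bar> < c * a \<Longrightarrow>
       \<xi> + a *\<^sub>R ?\<eta> \<xi> + b *\<^sub>R (\<i> *s ?\<eta> \<xi>) \<in> \<Omega>"
    using boundary_cusp[OF assms(4,8,10-12)] by blast
  \<comment> \<open>The monotonicity and continuity of \<open>\<omega>\<close> are assumed only
    through boundary points, so one such point has to exist.\<close>
  obtain \<xi>0 where "\<xi>0 \<in> frontier \<Omega>"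
    using boundary_nonempty by blast
  then have \<omega>: "mono_on {0..<2 * r} \<omega>" "continuous (at 0 within {0..<2 * r}) \<omega>" "\<omega> 0 = 0"
    using assms(12)[of \<xi>0] by (auto simp: has_modulus_of_continuity_def)
  show ?thesis
  proof (rule disc_chain_to_boundary[OF assms(9) \<omega> c])
    show "F 0 \<in> \<Omega>"
      using assms(13) by (auto simp: complex_geodesic_def holomorphic_discs_def)
  next
    fix C d0 :: real
    assume "0 < d0" "\<And>\<xi> d. \<xi> \<in> frontier \<Omega> \<Longrightarrow> 0 < d \<Longrightarrow> d \<le> d0 \<Longrightarrow>
       \<exists>L \<le> C - ln d / 2. disc_chain (holomorphic_discs \<Omega>) (F 0) (\<xi> + d *\<^sub>R ?\<eta> \<xi>) L"
    then show ?thesis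
      by (rule geodesic_boundary_extension[OF assms(13)])
  qed (fact cusp)
qed

end
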